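(* Let $m\in\mathbb{N}$, $m\ge 1$, and let $G$ be the generator of the damped wave equation with $q(x)=0$ and $a(x)=x^{2m}$, i.e. $G(\psi_1,\psi_2)^t=(\psi_2,\ \psi_1''-2x^{2m}\psi_2)^t$. Then for every $N\in\mathbb{N}$ and every $\varepsilon>0$ (independent of $\lambda$) there exists a $\lambda$-dependent family of nonzero functions $\{\Psi_\lambda\}\subset C_0^\infty(\mathbb{R})^2$ such that $$\|(G-\lambda)\Psi_\lambda\|_{\mathcal H}=\mathcal{O}(|\operatorname{Re}\lambda|^{-N})\,\|\Psi_\lambda\|_{\mathcal H}\qquad\text{as }\operatorname{Re}\lambda\to-\infty,$$ provided that $\lambda\in\mathbb{C}$ satisfies $$|\operatorname{Im}\lambda|\ \ge\ |\operatorname{Re}\lambda|^{-\frac1{2m}+\varepsilon}.$$ That is, there are constants $C,K>0$ such that $\|(G-\lambda)\Psi_\lambda\|_{\mathcal H}\le C|\operatorname{Re}\lambda|^{-N}\|\Psi_\lambda\|_{\mathcal H}$ for all $\lambda$ with $\operatorname{Re}\lambda\le -K$ and $|\operatorname{Im}\lambda|\ge|\operatorname{Re}\lambda|^{-\frac1{2m}+\varepsilon}$.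
   Context: The norm on $\mathcal H$, for pairs of compactly supported smooth functions and with $q=0$, is $\|(\psi_1,\psi_2)^t\|_{\mathcal H}^2=\|\psi_1'\|^2+\|\psi_2\|^2$, where $\|\cdot\|$ is the $L^2(\mathbb{R})$ norm. (In general $\mathcal H=\mathcal W(\mathbb{R})\times L^2(\mathbb{R})$, where $\mathcal W(\mathbb{R})$ is the completion of $C_0^\infty(\mathbb{R})$ with respect to $(\|\partial_x\cdot\|^2+\|q^{1/2}\cdot\|^2)^{1/2}$.) $C_0^\infty(\mathbb{R})$ denotes complex-valued smooth compactly supported functions. *)

theory Defs
  imports "HOL-Analysis.Analysis"
begin

definition D :: "(real \<Rightarrow> complex) \<Rightarrow> real \<Rightarrow> complex" where
  "D f = (\<lambda>x. vector_derivative f (at x))"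

definition smooth :: "(real \<Rightarrow> complex) \<Rightarrow> bool" where
  "smooth f \<longleftrightarrow> (\<forall>n x. (D ^^ n) f differentiable at x)"

text \<open>The space \<open>C\<^sub>0\<^sup>\<infinity>(\<real>)\<close> of complex-valued test functions.\<close>

definition test_functions :: "(real \<Rightarrow> complex) set" where
  "test_functions = {f. smooth f \<and> compact (closure {x. f x \<noteq> 0})}"

text \<open>The integral is \<open>0\<close> by convention when \<open>\<bar>f\<bar>\<^sup>2\<close> is not integrable, so this is the
  \<open>L\<^sup>2\<close> norm only for square-integrable \<open>f\<close>, in particular for test functions.\<close>

definition L2norm :: "(real \<Rightarrow> complex) \<Rightarrow> real" where
  "L2norm f = sqrt (LINT x|lborel. (cmod (f x))\<^sup>2)"

text \<open>The norm of \<open>\<H> = \<W>(\<real>) \<times> L\<^sup>2(\<real>)\<close>, restricted to pairs of test functions, on which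
  no completion is needed.\<close>

definition Hnorm :: "(real \<Rightarrow> real) \<Rightarrow> (real \<Rightarrow> complex) \<times> (real \<Rightarrow> complex) \<Rightarrow> real" where
  "Hnorm q \<Psi> = sqrt ((L2norm (D (fst \<Psi>)))\<^sup>2
      + (L2norm (\<lambda>x. of_real (sqrt (q x)) * fst \<Psi> x))\<^sup>2
      + (L2norm (snd \<Psi>))\<^sup>2)"

text \<open>The action on pairs of test functions of the generator for the damped wave equation
  \<open>u\<^sub>t\<^sub>t + 2 a u\<^sub>t = u\<^sub>x\<^sub>x - q u\<close> in the variables \<open>(u, u\<^sub>t)\<close>.\<close>

definition generator ::
  "(real \<Rightarrow> real) \<Rightarrow> (real \<Rightarrow> real) \<Rightarrow> (real \<Rightarrow> complex) \<times> (real \<Rightarrow> complex)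
    \<Rightarrow> (real \<Rightarrow> complex) \<times> (real \<Rightarrow> complex)" where
  "generator q a \<Psi> =
     (snd \<Psi>,
      \<lambda>x. D (D (fst \<Psi>)) x - of_real (q x) * fst \<Psi> x - 2 * of_real (a x) * snd \<Psi> x)"

definition generator_minus ::
  "(real \<Rightarrow> real) \<Rightarrow> (real \<Rightarrow> real) \<Rightarrow> complex \<Rightarrow> (real \<Rightarrow> complex) \<times> (real \<Rightarrow> complex)
    \<Rightarrow> (real \<Rightarrow> complex) \<times> (real \<Rightarrow> complex)" where
  "generator_minus q a l \<Psi> =
     (\<lambda>x. fst (generator q a \<Psi>) x - l * fst \<Psi> x,
      \<lambda>x. snd (generator q a \<Psi>) x - l * snd \<Psi> x)"

end

theory Submission
  imports Defs
begin

text \<open>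
  With \<open>\<Psi> = (\<psi>, \<lambda>\<psi>)\<close> the first component of \<open>(G - \<lambda>)\<Psi>\<close> vanishes and the second one is
  \<open>\<psi>'' - \<lambda>(\<lambda> + 2x\<^sup>2\<^sup>m)\<psi>\<close>, while the norm of \<open>\<Psi>\<close> is at least \<open>\<bar>\<lambda>\<bar> \<parallel>\<psi>\<parallel>\<close>. Let \<open>\<alpha> = - Re \<lambda>\<close>, let
  \<open>r = \<alpha>\<^sup>1\<^sup>/\<^sup>2\<^sup>m\<close> be the point where the imaginary part of the potential changes sign, and put
  \<open>x = r(1 + t)\<close>. The equation \<open>\<psi>'' = \<lambda>(\<lambda> + 2x\<^sup>2\<^sup>m)\<psi>\<close> becomes \<open>u'' + k\<^sup>2 V u = 0\<close> with
  \<open>V(t) = 1 - 2\<mu>((1 + t)\<^sup>2\<^sup>m - 1)\<close>, \<open>k = r\<bar>\<lambda>\<bar>\<close>, and \<open>\<mu>\<close> the quotient of \<open>\<alpha>\<close> by the conjugate of \<open>\<lambda>\<close>,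
  so that \<open>\<bar>\<mu>\<bar> \<le> 1\<close>.

  No expansion in powers of \<open>1/k\<close> is needed: the quasimode is a cutoff of an exact solution. The
  equation has entire solutions (\<open>entire_ode_solution\<close>). Take \<open>Im \<mu> \<le> 0\<close>, the other sign following by
  conjugation, put \<open>q = \<surd>V\<close>, and impose the eikonal relation \<open>u' = \<i>kqu\<close> at the complex point \<open>\<i>h\<close>.
  Along the segments from \<open>\<i>h\<close> to the points of the real interval \<open>[-h, h]\<close> the factor
  \<open>exp(\<i>k\<integral>q)\<close> grows, so the relation is stable there: \<open>\<bar>u' - \<i>kqu\<bar> \<le> M\<bar>u\<bar>\<close> on \<open>[-h, h]\<close> with \<open>M\<close>
  independent of \<open>k\<close> and \<open>\<mu>\<close> (\<open>WKB_segment\<close>). On the real line \<open>Re(\<i>kq)\<close> is comparable to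
  \<open>-\<gamma>t\<close> with \<open>\<gamma> = k\<bar>Im \<mu>\<bar>\<close>, and integrating gives two-sided Gaussian bounds for \<open>\<bar>u\<bar>\<^sup>2\<close>
  (\<open>gaussian_bounds\<close>, \<open>model_equation_solution\<close>).

  Multiplication by a smooth cutoff that equals \<open>1\<close> on \<open>[-h/2, h/2]\<close> produces an error supported where
  \<open>h/2 \<le> \<bar>t\<bar> \<le> h\<close>, hence of relative size \<open>exp(-c\<gamma>)\<close> up to a factor of order \<open>k\<close> that the scaling absorbs
  (\<open>model_quasimode\<close>). Finally \<open>\<gamma> = r\<alpha>\<bar>Im \<lambda>\<bar>/\<bar>\<lambda>\<bar>\<close>, which the hypothesis on \<open>Im \<lambda>\<close> bounds below by
  half of the power of \<open>\<alpha>\<close> with exponent \<open>min \<epsilon> 1\<close> (\<open>Gaussian_rate_lower_bound\<close>), and the exponential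
  of minus a positive power of \<open>\<alpha>\<close> is smaller than every power of \<open>\<alpha>\<close>.
\<close>

section \<open>Entire solutions of linear second-order equations\<close>

text \<open>The Taylor coefficients of the solution of \<open>u'' = w u\<close> with \<open>u(0) = a\<close>, \<open>u'(0) = b\<close>, where the
  argument \<open>w\<close> is the coefficient sequence of the potential.\<close>

fun ode_coeff :: "(nat \<Rightarrow> complex) \<Rightarrow> complex \<Rightarrow> complex \<Rightarrow> nat \<Rightarrow> complex" where
  "ode_coeff w a b 0 = a"
| "ode_coeff w a b (Suc 0) = b"
| "ode_coeff w a b (Suc (Suc n)) =
     (\<Sum>j=0..n. w j * ode_coeff w a b (n - j)) / (of_nat (n + 1) * of_nat (n + 2))"

text \<open>The recursion divides by \<open>(n + 1)(n + 2)\<close>, so from some index on a weighted coefficient is at most the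
  largest of its predecessors. As \<open>r\<close> is arbitrary for an entire potential, the solution is entire.\<close>

lemma ode_coeff_bounded:
  assumes r: "r > 0" and w: "summable (\<lambda>j. cmod (w j) * r ^ j)"
  shows "\<exists>B. \<forall>n. cmod (ode_coeff w a b n) * r ^ n \<le> B"
proof -
  define c where "c = ode_coeff w a b"
  define A where "A = (\<Sum>j. cmod (w j) * r ^ j)"
  have A0: "A \<ge> 0" unfolding A_def using r w by (intro suminf_nonneg) auto
  have Ale: "(\<Sum>j=0..n. cmod (w j) * r ^ j) \<le> A" for n
    unfolding A_def using r w by (intro sum_le_suminf) auto
  obtain n0 :: nat where n0: "r\<^sup>2 * A \<le> real n0" using real_arch_simple by blast
  define B where "B = (\<Sum>k\<le>Suc n0. cmod (c k) * r ^ k)"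
  have B0: "B \<ge> 0" unfolding B_def using r by (intro sum_nonneg) auto
  have "cmod (c n) * r ^ n \<le> B" for n
  proof (induction n rule: less_induct)
    case (less n)
    show ?case
    proof (cases "n \<le> Suc n0")
      case True
      then show ?thesis unfolding B_def using r
        by (intro member_le_sum) auto
    next
      case False
      then obtain k where n: "n = Suc (Suc k)" and k: "k \<ge> n0"
        by (metis Suc_le_D Suc_le_mono not_less_eq_eq)
      have ck: "c n = (\<Sum>j=0..k. w j * c (k - j)) / (of_nat (k + 1) * of_nat (k + 2))"
        unfolding n c_def by simp
      have "cmod (\<Sum>j=0..k. w j * c (k - j)) * r ^ k \<le> (\<Sum>j=0..k. cmod (w j * c (k - j))) * r ^ k"
        using r by (intro mult_right_mono norm_sum) auto
      also have "\<dots> = (\<Sum>j=0..k. (cmod (w j) * r ^ j) * (cmod (c (k - j)) * r ^ (k - j)))"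
        unfolding sum_distrib_right
      proof (rule sum.cong)
        fix j assume "j \<in> {0..k}"
        then have "r ^ k = r ^ j * r ^ (k - j)" by (simp flip: power_add)
        then show "cmod (w j * c (k - j)) * r ^ k
            = (cmod (w j) * r ^ j) * (cmod (c (k - j)) * r ^ (k - j))"
          by (simp add: norm_mult)
      qed simp
      also have "\<dots> \<le> (\<Sum>j=0..k. (cmod (w j) * r ^ j) * B)"
        using less r n by (intro sum_mono mult_left_mono) auto
      also have "\<dots> \<le> A * B"
        unfolding sum_distrib_right[symmetric] using Ale B0 by (intro mult_right_mono) auto
      finally have *: "cmod (\<Sum>j=0..k. w j * c (k - j)) * r ^ k \<le> A * B" .
      have "cmod (c n) * r ^ n
          = (cmod (\<Sum>j=0..k. w j * c (k - j)) * r ^ k) * r\<^sup>2 / (real (k + 1) * real (k + 2))"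
        unfolding ck norm_divide norm_mult norm_of_nat by (simp add: n power2_eq_square)
      also have "\<dots> \<le> (A * B) * r\<^sup>2 / (real (k + 1) * real (k + 2))"
        using * by (intro divide_right_mono mult_right_mono) auto
      also have "\<dots> = B * ((r\<^sup>2 * A) / (real (k + 1) * real (k + 2)))" by simp
      also have "\<dots> \<le> B * 1"
      proof (intro mult_left_mono B0)
        have "r\<^sup>2 * A \<le> real (k + 1) * 1" using n0 k by simp
        also have "\<dots> \<le> real (k + 1) * real (k + 2)" by (intro mult_left_mono) auto
        finally show "r\<^sup>2 * A / (real (k + 1) * real (k + 2)) \<le> 1" by simp
      qed
      finally show ?thesis by simp
    qed
  qed
  then show ?thesis unfolding c_def by blast
qed

lemma entire_ode_solution:
  fixes W :: "complex poly"
  shows "\<exists>u v. u z0 = a \<and> v z0 = b \<and>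
    (\<forall>z. (u has_field_derivative v z) (at z) \<and>
         (v has_field_derivative poly W z * u z) (at z))"
proof -
  define V where "V = fps_of_poly (pcompose W [:z0, 1:])"
  define F where "F = Abs_fps (ode_coeff (fps_nth V) a b)"
  have rV: "fps_conv_radius V = \<infinity>" unfolding V_def by simp
  have "conv_radius (fps_nth F) \<ge> \<infinity>"
  proof (rule conv_radius_geI_ex')
    fix r :: real assume r: "0 < r"
    have "summable (\<lambda>j. cmod (fps_nth V j * of_real (r + 1) ^ j))"
      using rV r by (intro norm_summable_fps) auto
    then have "summable (\<lambda>j. cmod (fps_nth V j) * (r + 1) ^ j)"
      using r by (simp add: norm_mult norm_power del: of_real_add)
    then obtain B where "cmod (ode_coeff (fps_nth V) a b n) * (r + 1) ^ n \<le> B" for n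
      using ode_coeff_bounded[of "r + 1"] r by fastforce
    then have "summable (\<lambda>n. cmod (fps_nth F n) * r ^ n)"
      unfolding F_def using r by (intro Abel_lemma[of r "r + 1"]) auto
    then show "summable (\<lambda>n. fps_nth F n * of_real r ^ n)"
      using r by - (rule summable_norm_cancel, simp add: norm_mult norm_power)
  qed
  then have rF: "fps_conv_radius F = \<infinity>" unfolding fps_conv_radius_def by simp
  then have rF': "fps_conv_radius (fps_deriv F) = \<infinity>"
    using fps_conv_radius_deriv[of F] by simp
  have F2: "fps_deriv (fps_deriv F) = V * F"
  proof (rule fps_ext)
    fix n
    define s where "s = (\<Sum>j=0..n. fps_nth V j * ode_coeff (fps_nth V) a b (n - j))"
    have "fps_nth (fps_deriv (fps_deriv F)) n
        = of_nat (n + 1) * (of_nat (n + 2) * (s / (of_nat (n + 1) * of_nat (n + 2))))"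
      unfolding F_def s_def by (simp add: algebra_simps)
    moreover have "of_nat (n + 1) \<noteq> (0::complex)" "of_nat (n + 2) \<noteq> (0::complex)"
      unfolding of_nat_eq_0_iff by simp_all
    then have "of_nat (n + 1) * (of_nat (n + 2) * (s / (of_nat (n + 1) * of_nat (n + 2)))) = s"
      by (simp del: of_nat_add)
    ultimately show "fps_nth (fps_deriv (fps_deriv F)) n = fps_nth (V * F) n"
      unfolding F_def s_def by (simp add: fps_mult_nth)
  qed
  have eV: "eval_fps (V * F) z = poly W (z + z0) * eval_fps F z" for z
    using rV rF by (subst eval_fps_mult) (auto simp: V_def poly_pcompose add.commute)
  define u where "u z = eval_fps F (z - z0)" for z
  define v where "v z = eval_fps (fps_deriv F) (z - z0)" for z
  have shift: "((\<lambda>z. eval_fps H (z - z0)) has_field_derivative eval_fps (fps_deriv H) (z - z0)) (at z)"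
    if "fps_conv_radius H = \<infinity>" for H z
  proof -
    have "((\<lambda>z. z - z0) has_field_derivative 1) (at z)"
      by (auto intro!: derivative_eq_intros)
    then show ?thesis
      using DERIV_chain2[of "eval_fps H" "eval_fps (fps_deriv H) (z - z0)" "\<lambda>z. z - z0" z 1 UNIV]
        has_field_derivative_eval_fps[of "z - z0" H UNIV] that
      by simp
  qed
  have "(u has_field_derivative v z) (at z)" for z
    unfolding u_def v_def by (rule shift[OF rF])
  moreover have "(v has_field_derivative poly W z * u z) (at z)" for z
    using shift[OF rF', of z] eV[of "z - z0"] unfolding u_def v_def by (simp add: F2)
  moreover have "u z0 = a" "v z0 = b"
    unfolding u_def v_def by (simp_all add: eval_fps_at_0 F_def)
  ultimately show ?thesis by blast
qed

section \<open>Comparison with the eikonal along segments\<close>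

lemma cmod_square_has_derivative:
  assumes "(g has_vector_derivative g') (at s)"
  shows "((\<lambda>s. (cmod (g s))\<^sup>2) has_real_derivative 2 * Re (cnj (g s) * g')) (at s)"
proof -
  have "((\<lambda>s. g s \<bullet> g s) has_real_derivative 2 * Re (cnj (g s) * g')) (at s)"
    using has_derivative_inner[OF assms[unfolded has_vector_derivative_def] assms[unfolded has_vector_derivative_def]]
    unfolding has_field_derivative_def
    by (rule has_derivative_eq_rhs) (auto simp: fun_eq_iff inner_complex_def algebra_simps)
  then show ?thesis by (simp add: dot_square_norm)
qed

text \<open>The eikonal relation \<open>u' = \<i>kqu\<close>, imposed at \<open>\<i>h\<close>, persists on the real interval \<open>[-h, h]\<close> up to an
  error \<open>M\<bar>u\<bar>\<close>. The defect \<open>y = u' - \<i>kqu\<close> satisfies \<open>y' = -\<i>kqy - \<i>kq'u\<close>, and \<open>u' = \<i>kqu + y\<close>. In the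
  direction \<open>d\<close> of the segment \<open>Re(\<i>kqd)\<close> is positive of order \<open>k\<close>, so \<open>y\<close> is damped while \<open>u\<close>
  grows, and \<open>M\<^sup>2\<bar>u\<bar>\<^sup>2 - \<bar>y\<bar>\<^sup>2\<close> is nondecreasing along the segment.\<close>

lemma WKB_segment:
  fixes u v q q' :: "complex \<Rightarrow> complex" and h k M t :: real
  assumes h: "h > 0" and t: "\<bar>t\<bar> \<le> h" and M: "M \<ge> 0" and k: "k \<ge> 4 * M"
    and u: "\<And>z. cmod z \<le> h \<Longrightarrow> (u has_field_derivative v z) (at z)"
    and v: "\<And>z. cmod z \<le> h \<Longrightarrow>
      (v has_field_derivative - (of_real k ^ 2 * q z ^ 2) * u z) (at z)"
    and q: "\<And>z. cmod z \<le> h \<Longrightarrow> (q has_field_derivative q' z) (at z)"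
    and q1: "\<And>z. cmod z \<le> h \<Longrightarrow> cmod (q z - 1) \<le> 1 / 4"
    and q'M: "\<And>z. cmod z \<le> h \<Longrightarrow> cmod (q' z) \<le> M / 4"
    and u0: "u (\<i> * of_real h) = 1"
    and v0: "v (\<i> * of_real h) = \<i> * of_real k * q (\<i> * of_real h)"
  shows "cmod (v (of_real t) - \<i> * of_real k * q (of_real t) * u (of_real t)) \<le> M * cmod (u (of_real t))"
    and "cmod (u (of_real t)) \<ge> 1"
proof -
  define d where "d = of_real t - \<i> * of_real h"
  define z where "z s = \<i> * of_real h + of_real s * d" for s :: real
  define y where "y z = v z - \<i> * of_real k * q z * u z" for z
  have k0: "k \<ge> 0" using k M by linarith
  have zb: "cmod (z s) \<le> h" if "0 \<le> s" "s \<le> 1" for s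
  proof -
    have "z s = of_real (1 - s) * (\<i> * of_real h) + of_real s * of_real t"
      unfolding z_def d_def by (simp add: algebra_simps)
    also have "cmod \<dots> \<le> (1 - s) * h + s * \<bar>t\<bar>"
      using norm_triangle_ineq[of "of_real (1 - s) * (\<i> * of_real h)" "of_real s * of_real t"]
        that h by (simp add: norm_mult del: of_real_diff)
    also have "\<dots> \<le> (1 - s) * h + s * h"
      using that t by (intro add_left_mono mult_left_mono) auto
    finally show ?thesis by (simp add: algebra_simps)
  qed
  have dle: "cmod d \<le> 3 / 2 * h"
  proof -
    have "(cmod d)\<^sup>2 = t\<^sup>2 + h\<^sup>2" unfolding d_def cmod_power2 by simp
    also have "\<dots> \<le> h\<^sup>2 + h\<^sup>2" using power_mono[OF t, of 2] by simp
    also have "\<dots> \<le> (3 / 2 * h)\<^sup>2" by (simp add: power2_eq_square)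
    finally show ?thesis by (rule power2_le_imp_le) (use h in auto)
  qed
  have rate: "Re (\<i> * of_real k * q (z s) * d) \<ge> h / 2 * k" if "0 \<le> s" "s \<le> 1" for s
  proof -
    have "cmod ((q (z s) - 1) * (\<i> * d)) \<le> 1 / 4 * (3 / 2 * h)"
      using mult_mono[OF q1[OF zb[OF that]] dle] by (simp add: norm_mult)
    then have "Re ((q (z s) - 1) * (\<i> * d)) \<ge> - (1 / 4 * (3 / 2 * h))"
      using abs_Re_le_cmod[of "(q (z s) - 1) * (\<i> * d)"] by linarith
    moreover have "Re (\<i> * d) = h" unfolding d_def by simp
    moreover have "Re (\<i> * q (z s) * d) = Re ((q (z s) - 1) * (\<i> * d)) + Re (\<i> * d)"
      by (simp add: algebra_simps)
    ultimately have *: "Re (\<i> * q (z s) * d) \<ge> h / 2" using h by linarith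
    have "\<i> * of_real k * q (z s) * d = of_real k * (\<i> * q (z s) * d)" by (simp add: mult_ac)
    then have "Re (\<i> * of_real k * q (z s) * d) = k * Re (\<i> * q (z s) * d)"
      by (simp only: Re_complex_of_real Im_complex_of_real times_complex.sel)
    then show ?thesis using mult_left_mono[OF * k0] by (simp add: mult.commute)
  qed
  have z': "(z has_vector_derivative d) (at s)" for s
    unfolding z_def by (auto intro!: derivative_eq_intros simp: has_vector_derivative_def fun_eq_iff scaleR_conv_of_real)
  have chain: "((\<lambda>s. f (z s)) has_vector_derivative d * f') (at s)"
    if "(f has_field_derivative f') (at (z s))" for f f' s
    using field_vector_diff_chain_at[OF z' that] by (simp add: o_def)
  have y': "(y has_field_derivative - (\<i> * of_real k * (q w * y w + q' w * u w))) (at w)"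
    if "cmod w \<le> h" for w
    unfolding y_def
    by (rule derivative_eq_intros refl u v q that)+
      (simp add: algebra_simps power2_eq_square)
  define F where "F s = M\<^sup>2 * (cmod (u (z s)))\<^sup>2 - (cmod (y (z s)))\<^sup>2" for s
  define F' where "F' s = M\<^sup>2 * (2 * Re (cnj (u (z s)) * (d * v (z s))))
      - 2 * Re (cnj (y (z s)) * (d * - (\<i> * of_real k * (q (z s) * y (z s) + q' (z s) * u (z s)))))" for s
  have F': "(F has_real_derivative F' s) (at s)" if "0 \<le> s" "s \<le> 1" for s
    unfolding F_def F'_def
    by (intro DERIV_diff DERIV_cmult cmod_square_has_derivative chain u y' zb that)
  have cc: "Re (cnj a * (w * a)) = (cmod a)\<^sup>2 * Re w" for a w
    unfolding cmod_power2 by (simp add: algebra_simps power2_eq_square)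
  have F'nonneg: "F' s \<ge> 0" if s: "0 \<le> s" "s \<le> 1" for s
  proof -
    define U Y where "U = cmod (u (z s))" and "Y = cmod (y (z s))"
    define e where "e = Re (\<i> * of_real k * q (z s) * d)"
    define R S where "R = Re (cnj (u (z s)) * d * y (z s))"
      and "S = Re (cnj (y (z s)) * d * (\<i> * of_real k * q' (z s) * u (z s)))"
    define G where "G = h * k * M * (U * Y)"
    have UY: "U \<ge> 0" "Y \<ge> 0" by (auto simp: U_def Y_def)
    have G0: "G \<ge> 0" using UY h k0 M by (simp add: G_def)
    have e: "e \<ge> h / 2 * k" unfolding e_def by (rule rate[OF s])
    have vz: "v (z s) = \<i> * of_real k * q (z s) * u (z s) + y (z s)" by (simp add: y_def)
    have "cnj (u (z s)) * (d * v (z s))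
        = cnj (u (z s)) * ((\<i> * of_real k * q (z s) * d) * u (z s)) + cnj (u (z s)) * d * y (z s)"
      unfolding vz by (simp add: algebra_simps)
    then have 1: "Re (cnj (u (z s)) * (d * v (z s))) = U\<^sup>2 * e + R"
      by (simp only: plus_complex.sel cc U_def e_def R_def)
    have "cnj (y (z s)) * (d * - (\<i> * of_real k * (q (z s) * y (z s) + q' (z s) * u (z s))))
        = - (cnj (y (z s)) * ((\<i> * of_real k * q (z s) * d) * y (z s)))
          - cnj (y (z s)) * d * (\<i> * of_real k * q' (z s) * u (z s))"
      by (simp add: algebra_simps)
    then have 2: "Re (cnj (y (z s)) * (d * - (\<i> * of_real k * (q (z s) * y (z s) + q' (z s) * u (z s)))))
        = - (Y\<^sup>2 * e) - S"
      by (simp only: minus_complex.sel uminus_complex.sel cc Y_def e_def S_def)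
    have F's: "F' s = 2 * (M\<^sup>2 * (U\<^sup>2 * e) + M\<^sup>2 * R + (Y\<^sup>2 * e + S))"
      unfolding F'_def 1 2 by (simp add: algebra_simps)
    have "\<bar>M\<^sup>2 * R\<bar> \<le> M\<^sup>2 * (U * cmod d * Y)"
      using abs_Re_le_cmod[of "cnj (u (z s)) * d * y (z s)"]
      unfolding abs_mult by (intro mult_mono) (simp_all add: norm_mult R_def U_def Y_def)
    also have "\<dots> \<le> M\<^sup>2 * (U * (3 / 2 * h) * Y)"
      using UY dle by (intro mult_left_mono mult_right_mono) auto
    also have "\<dots> = (4 * M) * (3 / 8 * h * M * (U * Y))" by (simp add: power2_eq_square)
    also have "\<dots> \<le> k * (3 / 8 * h * M * (U * Y))"
      using k h M UY by (intro mult_right_mono) auto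
    also have "\<dots> = 3 / 8 * G" by (simp add: G_def)
    finally have 3: "\<bar>M\<^sup>2 * R\<bar> \<le> 3 / 8 * G" .
    have "\<bar>S\<bar> \<le> Y * cmod d * (k * cmod (q' (z s)) * U)"
      using abs_Re_le_cmod[of "cnj (y (z s)) * d * (\<i> * of_real k * q' (z s) * u (z s))"] k0
      by (simp add: norm_mult U_def Y_def S_def)
    also have "\<dots> \<le> Y * (3 / 2 * h) * (k * (M / 4) * U)"
      using UY k0 M h dle q'M[OF zb[OF s]]
      by (intro mult_mono) auto
    also have "\<dots> = 3 / 8 * G" by (simp add: G_def)
    finally have 4: "\<bar>S\<bar> \<le> 3 / 8 * G" .
    \<comment> \<open>The growth terms outweigh the two cross terms, by the inequality between the means.\<close>
    have "G = h / 2 * k * (2 * (M * U) * Y)" by (simp add: G_def)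
    also have "\<dots> \<le> h / 2 * k * ((M * U)\<^sup>2 + Y\<^sup>2)"
      using h k0 by (intro mult_left_mono sum_squares_bound) auto
    also have "\<dots> \<le> e * ((M * U)\<^sup>2 + Y\<^sup>2)"
      by (intro mult_right_mono e) auto
    also have "\<dots> = M\<^sup>2 * (U\<^sup>2 * e) + Y\<^sup>2 * e"
      by (simp add: algebra_simps power_mult_distrib)
    finally have 5: "G \<le> M\<^sup>2 * (U\<^sup>2 * e) + Y\<^sup>2 * e" .
    have "0 \<le> 2 * (a + b + (c + d))" if "G \<le> a + c" "- b \<le> 3 / 8 * G" "- d \<le> 3 / 8 * G" for a b c d
      using that G0 by argo
    then show ?thesis unfolding F's using 5 abs_le_D2[OF 3] abs_le_D2[OF 4] by blast
  qed
  have Fnonneg: "F s \<ge> 0" if "0 \<le> s" "s \<le> 1" for s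
  proof -
    have "F 0 \<le> F s"
      by (rule DERIV_nonneg_imp_nondecreasing[OF that(1)]) (use F' F'nonneg that in force)
    moreover have "F 0 \<ge> 0" by (simp add: F_def z_def y_def u0 v0)
    ultimately show ?thesis by linarith
  qed
  have ybound: "cmod (y (z s)) \<le> M * cmod (u (z s))" if "0 \<le> s" "s \<le> 1" for s
    using Fnonneg[OF that] M unfolding F_def
    by - (rule power2_le_imp_le, auto simp: power_mult_distrib)
  define n where "n s = (cmod (u (z s)))\<^sup>2" for s
  have n': "\<exists>n'. (n has_real_derivative n') (at s) \<and> n' \<ge> 0" if s: "0 \<le> s" "s \<le> 1" for s
  proof (intro exI conjI)
    show "(n has_real_derivative 2 * Re (cnj (u (z s)) * (d * v (z s)))) (at s)"
      unfolding n_def by (intro cmod_square_has_derivative chain u zb s)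
    have vz: "v (z s) = \<i> * of_real k * q (z s) * u (z s) + y (z s)" by (simp add: y_def)
    have "cnj (u (z s)) * (d * v (z s))
        = cnj (u (z s)) * ((\<i> * of_real k * q (z s) * d) * u (z s)) + cnj (u (z s)) * d * y (z s)"
      unfolding vz by (simp add: algebra_simps)
    then have 1: "Re (cnj (u (z s)) * (d * v (z s)))
        = n s * Re (\<i> * of_real k * q (z s) * d) + Re (cnj (u (z s)) * d * y (z s))"
      by (simp only: plus_complex.sel cc n_def)
    have "\<bar>Re (cnj (u (z s)) * d * y (z s))\<bar> \<le> cmod (u (z s)) * cmod d * cmod (y (z s))"
      using abs_Re_le_cmod[of "cnj (u (z s)) * d * y (z s)"] by (simp add: norm_mult)
    also have "\<dots> \<le> cmod (u (z s)) * (3 / 2 * h) * (M * cmod (u (z s)))"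
      using dle ybound[OF s] h by (intro mult_mono) auto
    also have "\<dots> = n s * (3 / 2 * h * M)" by (simp add: n_def power2_eq_square)
    also have "\<dots> \<le> n s * (h / 2 * k)"
      using mult_left_mono[OF k, of h] h M mult_nonneg_nonneg[of h M]
      by (intro mult_left_mono) (auto simp: n_def)
    also have "\<dots> \<le> n s * Re (\<i> * of_real k * q (z s) * d)"
      by (intro mult_left_mono rate s) (simp add: n_def)
    finally have 2: "\<bar>Re (cnj (u (z s)) * d * y (z s))\<bar> \<le> n s * Re (\<i> * of_real k * q (z s) * d)" .
    have "0 \<le> 2 * (a + b)" if "\<bar>b\<bar> \<le> a" for a b :: real
      using abs_le_D2[OF that] by simp
    then show "2 * Re (cnj (u (z s)) * (d * v (z s))) \<ge> 0" unfolding 1 using 2 by blast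
  qed
  have "n 0 \<le> n 1"
    by (rule DERIV_nonneg_imp_nondecreasing) (use n' in auto)
  then have "1 \<le> (cmod (u (of_real t)))\<^sup>2" by (simp add: n_def z_def d_def u0)
  then show "cmod (u (of_real t)) \<ge> 1"
    using power2_le_imp_le[of 1 "cmod (u (of_real t))"] by simp
  show "cmod (v (of_real t) - \<i> * of_real k * q (of_real t) * u (of_real t)) \<le> M * cmod (u (of_real t))"
    using ybound[of 1] by (simp add: y_def z_def d_def)
qed

section \<open>Gaussian bounds for the model equation\<close>

lemma linear_rate_comparison:
  fixes n n' :: "real \<Rightarrow> real"
  assumes "t \<ge> 0"
    and n: "\<And>s. 0 \<le> s \<Longrightarrow> s \<le> t \<Longrightarrow> (n has_real_derivative n' s) (at s)"
    and n': "\<And>s. 0 \<le> s \<Longrightarrow> s \<le> t \<Longrightarrow> n' s \<le> 2 * (a * s + b) * n s"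
  shows "n t \<le> n 0 * exp (a * t\<^sup>2 + 2 * b * t)"
proof -
  define g where "g s = n s * exp (- (a * s\<^sup>2 + 2 * b * s))" for s
  have "g t \<le> g 0"
  proof (rule DERIV_nonpos_imp_nonincreasing[OF \<open>t \<ge> 0\<close>])
    fix s assume s: "0 \<le> s" "s \<le> t"
    have "(g has_real_derivative (n' s - 2 * (a * s + b) * n s) * exp (- (a * s\<^sup>2 + 2 * b * s))) (at s)"
      unfolding g_def by (rule derivative_eq_intros n s refl)+ (simp add: algebra_simps)
    moreover have "(n' s - 2 * (a * s + b) * n s) * exp (- (a * s\<^sup>2 + 2 * b * s)) \<le> 0"
      using n'[OF s] by (intro mult_nonpos_nonneg) auto
    ultimately show "\<exists>y. (g has_real_derivative y) (at s) \<and> y \<le> 0" by blast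
  qed
  then have "n t * exp (- (a * t\<^sup>2 + 2 * b * t)) \<le> n 0" by (simp add: g_def)
  then show ?thesis by (simp only: exp_minus divide_inverse[symmetric]) (simp add: pos_divide_le_eq)
qed

text \<open>If the logarithmic derivative of \<open>u\<close> is within \<open>M\<close> of a function whose real part lies between
  \<open>-Bt\<close> and \<open>-At\<close> (for \<open>t > 0\<close>, and symmetrically for \<open>t < 0\<close>), then \<open>\<bar>u\<bar>\<^sup>2\<close> is squeezed between
  Gaussians up to factors \<open>exp(\<plusminus>2M\<bar>t\<bar>)\<close>.\<close>

lemma gaussian_bounds:
  fixes u v w :: "real \<Rightarrow> complex"
  assumes u: "\<And>t. \<bar>t\<bar> \<le> h \<Longrightarrow> (u has_vector_derivative v t) (at t)"
    and v: "\<And>t. \<bar>t\<bar> \<le> h \<Longrightarrow> cmod (v t - w t * u t) \<le> M * cmod (u t)"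
    and w: "\<And>t. \<bar>t\<bar> \<le> h \<Longrightarrow> A * t\<^sup>2 \<le> - (t * Re (w t)) \<and> - (t * Re (w t)) \<le> B * t\<^sup>2"
    and w0: "Re (w 0) = 0"
    and t: "\<bar>t\<bar> \<le> h"
  shows "(cmod (u t))\<^sup>2 \<le> (cmod (u 0))\<^sup>2 * exp (- A * t\<^sup>2 + 2 * M * \<bar>t\<bar>)"
    and "(cmod (u t))\<^sup>2 \<ge> (cmod (u 0))\<^sup>2 * exp (- B * t\<^sup>2 - 2 * M * \<bar>t\<bar>)"
proof -
  \<comment> \<open>The sign \<open>c\<close> of \<open>t\<close> reduces both half-lines to an interval starting at \<open>0\<close>.\<close>
  define c :: real where "c = (if t \<ge> 0 then 1 else - 1)"
  have c: "c * \<bar>t\<bar> = t" "c\<^sup>2 = 1" "\<bar>c\<bar> = 1" "c * c = 1" by (auto simp: c_def)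
  define n where "n s = (cmod (u (c * s)))\<^sup>2" for s
  define n' where "n' s = 2 * Re (cnj (u (c * s)) * v (c * s)) * c" for s
  have dn: "(n has_real_derivative n' s) (at s)" if s: "0 \<le> s" "s \<le> \<bar>t\<bar>" for s
  proof -
    have "\<bar>c * s\<bar> \<le> h" using s t c by (simp add: abs_mult)
    then have "((\<lambda>s. (cmod (u s))\<^sup>2) has_real_derivative 2 * Re (cnj (u (c * s)) * v (c * s))) (at (c * s))"
      by (intro cmod_square_has_derivative u)
    moreover have "((*) c has_real_derivative c) (at s)"
      by (auto intro!: derivative_eq_intros)
    ultimately show ?thesis
      unfolding n_def n'_def by (rule DERIV_chain2)
  qed
  have n': "n' s \<le> 2 * (- A * s + M) * n s \<and> n' s \<ge> 2 * (- B * s + - M) * n s"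
    if s: "0 \<le> s" "s \<le> \<bar>t\<bar>" for s
  proof -
    define r where "r = c * s"
    define \<delta> where "\<delta> = c * Re (cnj (u r) * (v r - w r * u r))"
    have r: "\<bar>r\<bar> \<le> h" using s t c by (simp add: abs_mult r_def)
    have "cnj (u r) * v r = cnj (u r) * u r * w r + cnj (u r) * (v r - w r * u r)"
      by (simp add: algebra_simps)
    also have "cnj (u r) * u r = of_real (n s)"
      by (simp add: n_def r_def complex_norm_square mult.commute flip: of_real_power)
    finally have "Re (cnj (u r) * v r) = n s * Re (w r) + Re (cnj (u r) * (v r - w r * u r))"
      by simp
    then have n's: "n' s = 2 * (n s * (c * Re (w r)) + \<delta>)"
      unfolding n'_def \<delta>_def r_def[symmetric] by (simp add: algebra_simps)
    have "\<bar>\<delta>\<bar> \<le> cmod (u r) * cmod (v r - w r * u r)"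
      using abs_Re_le_cmod[of "cnj (u r) * (v r - w r * u r)"] c
      by (simp add: \<delta>_def abs_mult norm_mult)
    also have "\<dots> \<le> cmod (u r) * (M * cmod (u r))"
      by (intro mult_left_mono v r) auto
    also have "\<dots> = M * n s" by (simp add: n_def r_def power2_eq_square)
    finally have \<delta>: "\<bar>\<delta>\<bar> \<le> M * n s" .
    have wr: "- (B * s) \<le> c * Re (w r) \<and> c * Re (w r) \<le> - (A * s)"
    proof (cases "s = 0")
      case True
      then show ?thesis using w0 by (simp add: r_def)
    next
      case False
      have "r\<^sup>2 = s * s" using c by (simp add: r_def power_mult_distrib power2_eq_square)
      then have "s * (A * s) \<le> s * - (c * Re (w r)) \<and> s * - (c * Re (w r)) \<le> s * (B * s)"
        using w[OF r] by (simp add: r_def mult_ac)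
      then have "A * s \<le> - (c * Re (w r)) \<and> - (c * Re (w r)) \<le> B * s"
        using False s by (metis mult_le_cancel_left_pos order_le_less)
      then show ?thesis by linarith
    qed
    have n0: "n s \<ge> 0" by (simp add: n_def)
    have "n s * (c * Re (w r)) \<le> n s * - (A * s)" "n s * (c * Re (w r)) \<ge> n s * - (B * s)"
      using mult_left_mono[OF conjunct2[OF wr] n0] mult_left_mono[OF conjunct1[OF wr] n0]
      by simp_all
    then show ?thesis unfolding n's using \<delta> by (simp add: algebra_simps abs_le_iff)
  qed
  have "n \<bar>t\<bar> \<le> n 0 * exp (- A * \<bar>t\<bar>\<^sup>2 + 2 * M * \<bar>t\<bar>)"
    by (rule linear_rate_comparison[of _ n n']) (use dn n' in auto)
  then show "(cmod (u t))\<^sup>2 \<le> (cmod (u 0))\<^sup>2 * exp (- A * t\<^sup>2 + 2 * M * \<bar>t\<bar>)"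
    unfolding n_def c by simp
  have "- n \<bar>t\<bar> \<le> - n 0 * exp (- B * \<bar>t\<bar>\<^sup>2 + 2 * - M * \<bar>t\<bar>)"
    by (rule linear_rate_comparison[of _ "\<lambda>s. - n s" "\<lambda>s. - n' s"])
      (use n' in \<open>auto intro!: DERIV_minus dn\<close>)
  then show "(cmod (u t))\<^sup>2 \<ge> (cmod (u 0))\<^sup>2 * exp (- B * t\<^sup>2 - 2 * M * \<bar>t\<bar>)"
    unfolding n_def c by simp
qed

text \<open>A complex disc on which the potential \<open>1 - 2\<mu>((1 + z)\<^sup>j - 1)\<close> stays close to \<open>1\<close>, uniformly for
  \<open>\<bar>\<mu>\<bar> \<le> 1\<close>.\<close>

lemma monomial_perturbation_bounds:
  assumes "j \<ge> 1"
  shows "\<exists>h P. 0 < h \<and> h \<le> 1 / 2 \<and> 1 \<le> P \<and> (\<forall>z :: complex. cmod z \<le> h \<longrightarrow>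
    cmod ((1 + z) ^ j - 1) \<le> 1 / 8 \<and> cmod (of_nat j * (1 + z) ^ (j - 1)) \<le> P \<and>
    cmod ((1 + z) ^ j - 1) \<le> P * cmod z)"
proof -
  define P where "P = real j * 2 ^ (j - 1)"
  define h where "h = 1 / (8 * P)"
  have P: "P \<ge> 1" unfolding P_def using assms mult_mono[of 1 "real j" 1 "2 ^ (j - 1)"] by simp
  have h: "0 < h" "h \<le> 1 / 8" unfolding h_def using P by (auto simp: field_simps)
  have dP: "cmod (of_nat j * (1 + z) ^ (j - 1)) \<le> P" if "cmod z \<le> h" for z
  proof -
    have "cmod (1 + z) \<le> 2" using norm_triangle_ineq[of 1 z] that h by simp
    then show ?thesis unfolding P_def norm_mult norm_power
      by (auto intro!: mult_left_mono power_mono)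
  qed
  have b: "cmod ((1 + z) ^ j - 1) \<le> P * cmod z" if z: "cmod z \<le> h" for z
  proof -
    have "cmod ((1 + z) ^ j - (1 + 0) ^ j) \<le> P * cmod (z - 0)"
    proof (rule field_differentiable_bound[of "cball 0 h"])
      show "((\<lambda>z. (1 + z) ^ j) has_field_derivative of_nat j * (1 + x) ^ (j - 1)) (at x within cball 0 h)" for x
        by (auto intro!: derivative_eq_intros)
    qed (use dP z h in auto)
    then show ?thesis by simp
  qed
  have "cmod ((1 + z) ^ j - 1) \<le> 1 / 8" if z: "cmod z \<le> h" for z
  proof -
    have "P * cmod z \<le> P * h" using z P by (intro mult_left_mono) auto
    also have "P * h = 1 / 8" using P by (simp add: h_def)
    finally show ?thesis using b[OF z] by linarith
  qed
  then show ?thesis using h P dP b by (intro exI[of _ h] exI[of _ P]) auto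
qed

text \<open>A pair \<open>(u, v)\<close> with \<open>v = u'\<close> solving the equation
  \<open>u'' + k\<^sup>2 (1 - 2 \<mu> ((1 + t)\<^sup>j - 1)) u = 0\<close> on the whole line, with two-sided Gaussian bounds on
  \<open>[-h, h]\<close>. The rate \<open>k \<bar>Im \<mu>\<bar>\<close> is the large parameter; \<open>h\<close> and \<open>P\<close> are
  parameters that will be chosen in terms of \<open>j\<close> only.\<close>

definition gaussian_solution ::
  "nat \<Rightarrow> real \<Rightarrow> real \<Rightarrow> real \<Rightarrow> complex \<Rightarrow> (real \<Rightarrow> complex) \<Rightarrow> (real \<Rightarrow> complex) \<Rightarrow> bool" where
  "gaussian_solution j h P k \<mu> u v \<longleftrightarrow>
    (\<forall>t. (u has_vector_derivative v t) (at t)) \<and>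
    (\<forall>t. (v has_vector_derivative
        - (of_real (k\<^sup>2) * (1 - 2 * \<mu> * of_real ((1 + t) ^ j - 1))) * u t) (at t)) \<and>
    u 0 \<noteq> 0 \<and>
    (\<forall>t. \<bar>t\<bar> \<le> h \<longrightarrow> cmod (v t) \<le> 2 * k * cmod (u t) \<and>
       (cmod (u t))\<^sup>2 \<le> (cmod (u 0))\<^sup>2 * exp (- (k * \<bar>Im \<mu>\<bar> / 2) * t\<^sup>2 + 2 * (6 * P) * \<bar>t\<bar>) \<and>
       (cmod (u t))\<^sup>2 \<ge> (cmod (u 0))\<^sup>2 * exp (- (2 * P * (k * \<bar>Im \<mu>\<bar>)) * t\<^sup>2 - 2 * (6 * P) * \<bar>t\<bar>))"

lemma model_equation_solution_nonpos:
  assumes h: "0 < h" "h \<le> 1 / 2" and P: "P \<ge> 1" and j: "j \<ge> 1"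
    and near: "\<And>z :: complex. cmod z \<le> h \<Longrightarrow>
      cmod ((1 + z) ^ j - 1) \<le> 1 / 8 \<and> cmod (of_nat j * (1 + z) ^ (j - 1)) \<le> P \<and>
      cmod ((1 + z) ^ j - 1) \<le> P * cmod z"
    and k: "k \<ge> 24 * P" and \<mu>: "cmod \<mu> \<le> 1" "Im \<mu> \<le> 0"
  shows "\<exists>u v. gaussian_solution j h P k \<mu> u v"
proof -
  define p where "p z = (1 + z) ^ j - (1 :: complex)" for z
  define p' where "p' z = of_nat j * (1 + z) ^ (j - 1)" for z :: complex
  define V where "V z = 1 - 2 * \<mu> * p z" for z
  define q where "q z = csqrt (V z)" for z
  define q' where "q' z = - (2 * \<mu> * p' z) / (2 * q z)" for z
  define \<gamma> where "\<gamma> = k * \<bar>Im \<mu>\<bar>"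
  have k0: "k > 0" using k P by linarith
  have \<gamma>0: "\<gamma> \<ge> 0" using k0 by (simp add: \<gamma>_def)
  have p_le: "cmod (p z) \<le> 1 / 8" "cmod (p' z) \<le> P" "cmod (p z) \<le> P * cmod z" if "cmod z \<le> h" for z
    using near[OF that] by (auto simp: p_def p'_def)
  have p': "(p has_field_derivative p' z) (at z)" for z
    unfolding p_def p'_def by (auto intro!: derivative_eq_intros)
  have V1: "cmod (V z - 1) \<le> 1 / 4" if "cmod z \<le> h" for z
  proof -
    have "cmod (V z - 1) = 2 * (cmod \<mu> * cmod (p z))" by (simp add: V_def norm_mult)
    also have "\<dots> \<le> 2 * (1 * (1 / 8))"
      using \<mu> p_le[OF that] by (intro mult_left_mono mult_mono) auto
    finally show ?thesis by simp
  qed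
  have q2: "q z ^ 2 = V z" for z by (simp add: q_def)
  have Re_q: "Re (q z) \<ge> 0" for z unfolding q_def using csqrt_principal[of "V z"] by auto
  have q1: "cmod (q z - 1) \<le> 1 / 4" if "cmod z \<le> h" for z
  proof -
    have "1 \<le> Re (q z + 1)" using Re_q[of z] by simp
    also have "\<dots> \<le> cmod (q z + 1)" by (rule complex_Re_le_cmod)
    finally have "cmod (q z - 1) * 1 \<le> cmod (q z - 1) * cmod (q z + 1)"
      by (intro mult_left_mono) auto
    also have "\<dots> = cmod (V z - 1)"
      by (simp flip: norm_mult q2 add: algebra_simps power2_eq_square)
    finally show ?thesis using V1[OF that] by simp
  qed
  have q_lower: "cmod (q z) \<ge> 3 / 4" and q_upper: "cmod (q z) \<le> 5 / 4"
    and Re_q_lower: "Re (q z) \<ge> 3 / 4" if "cmod z \<le> h" for z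
    using q1[OF that] norm_triangle_ineq3[of "q z" 1] abs_Re_le_cmod[of "q z - 1"]
    by (auto simp: abs_le_iff)
  have q': "(q has_field_derivative q' z) (at z)" if "cmod z \<le> h" for z
  proof -
    have "Re (V z) \<ge> 3 / 4" using V1[OF that] abs_Re_le_cmod[of "V z - 1"] by auto
    then have "V z \<notin> \<real>\<^sub>\<le>\<^sub>0" by (auto simp: complex_nonpos_Reals_iff)
    moreover have "(V has_field_derivative - (2 * \<mu> * p' z)) (at z)"
      unfolding V_def by (auto intro!: derivative_eq_intros p')
    ultimately show ?thesis
      unfolding q'_def q_def using has_field_derivative_csqrt' by blast
  qed
  have q'_le: "cmod (q' z) \<le> 6 * P / 4" if "cmod z \<le> h" for z
  proof -
    have "cmod (q' z) = cmod \<mu> * cmod (p' z) / cmod (q z)"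
      by (simp add: q'_def norm_mult norm_divide)
    also have "\<dots> \<le> (1 * P) / (3 / 4)"
      using \<mu> P p_le[OF that] q_lower[OF that] by (intro frac_le mult_mono) auto
    also have "\<dots> \<le> 6 * P / 4" using P by simp
    finally show ?thesis .
  qed
  define W where "W = smult (- (of_real k ^ 2)) (1 - smult (2 * \<mu>) ([:1, 1:] ^ j - 1))"
  have W: "poly W z = - (of_real k ^ 2 * q z ^ 2)" for z
    by (simp add: W_def q2 V_def p_def poly_power)
  obtain U U' where U: "U (\<i> * of_real h) = 1" "U' (\<i> * of_real h) = \<i> * of_real k * q (\<i> * of_real h)"
    "\<And>z. (U has_field_derivative U' z) (at z)"
    "\<And>z. (U' has_field_derivative - (of_real k ^ 2 * q z ^ 2) * U z) (at z)"
    using entire_ode_solution[of "\<i> * of_real h" 1 "\<i> * of_real k * q (\<i> * of_real h)" W]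
    unfolding W by blast
  define u where "u t = U (of_real t)" for t :: real
  define v where "v t = U' (of_real t)" for t :: real
  define w where "w t = \<i> * of_real k * q (of_real t)" for t :: real
  have seg: "cmod (v t - w t * u t) \<le> 6 * P * cmod (u t)" "cmod (u t) \<ge> 1" if "\<bar>t\<bar> \<le> h" for t
    unfolding u_def v_def w_def
    by (rule WKB_segment[of h t "6 * P" k U U' q q']; use h P k that U q' q1 q'_le in auto)+
  have u': "(u has_vector_derivative v t) (at t)" for t
    unfolding u_def v_def by (rule has_vector_derivative_real_field) (rule U)
  have v': "(v has_vector_derivative
      - (of_real (k\<^sup>2) * (1 - 2 * \<mu> * of_real ((1 + t) ^ j - 1))) * u t) (at t)" for t
    using has_vector_derivative_real_field[OF U(4)[of "of_real t"]]
    unfolding u_def v_def q2 V_def p_def by simp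
  \<comment> \<open>The real part of \<open>\<i>kq\<close> equals \<open>-\<gamma>((1 + t)\<^sup>j - 1)/Re q\<close>, which follows from
    \<open>2 Re q Im q = Im V\<close>. As \<open>Im \<mu> \<le> 0\<close>, its product with \<open>t\<close> is nonpositive.\<close>
  have w: "\<gamma> / 2 * t\<^sup>2 \<le> - (t * Re (w t)) \<and> - (t * Re (w t)) \<le> 2 * P * \<gamma> * t\<^sup>2"
    if t: "\<bar>t\<bar> \<le> h" for t
  proof -
    define \<pi> where "\<pi> = (1 + t) ^ j - 1"
    have c: "cmod (of_real t) \<le> h" using t by simp
    have p\<pi>: "p (of_real t) = of_real \<pi>" by (simp add: p_def \<pi>_def)
    define a where "a = Re (q (of_real t))"
    have a: "3 / 4 \<le> a" "a \<le> 5 / 4"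
      using Re_q_lower[OF c] q_upper[OF c] complex_Re_le_cmod[of "q (of_real t)"] by (auto simp: a_def)
    have "Im (q (of_real t) ^ 2) = - 2 * Im \<mu> * \<pi>"
      unfolding q2 V_def p\<pi> by simp
    then have "a * Im (q (of_real t)) = \<bar>Im \<mu>\<bar> * \<pi>"
      using \<mu>(2) by (simp add: power2_eq_square a_def mult.commute)
    then have "a * Re (w t) = - \<gamma> * \<pi>"
      by (simp add: w_def \<gamma>_def)
    then have "Re (w t) = - \<gamma> * \<pi> / a" using a by (simp add: field_simps)
    then have wt: "- (t * Re (w t)) = \<gamma> * ((t * \<pi>) / a)" by simp
    have t\<pi>: "t\<^sup>2 \<le> t * \<pi>"
    proof (cases "t \<ge> 0")
      case True
      then have "t \<le> \<pi>" unfolding \<pi>_def using power_increasing[of 1 j "1 + t"] j by simp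
      then show ?thesis using True by (simp add: power2_eq_square mult_left_mono)
    next
      case False
      then have "\<pi> \<le> t" unfolding \<pi>_def using power_decreasing[of 1 j "1 + t"] j t h by simp
      then show ?thesis using False by (simp add: power2_eq_square mult_left_mono_neg)
    qed
    have "\<bar>\<pi>\<bar> \<le> P * \<bar>t\<bar>" using p_le(3)[OF c] unfolding p\<pi> by simp
    then have "\<bar>t\<bar> * \<bar>\<pi>\<bar> \<le> \<bar>t\<bar> * (P * \<bar>t\<bar>)" by (intro mult_left_mono) auto
    then have t\<pi>': "t * \<pi> \<le> P * t\<^sup>2" by (simp add: power2_eq_square abs_mult[symmetric] mult_ac)
    have "t\<^sup>2 / 2 \<le> t * \<pi> / a"
    proof -
      have "t\<^sup>2 / 2 * a \<le> t\<^sup>2 / 2 * 2" using a by (intro mult_left_mono) auto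
      then show ?thesis using a t\<pi> by (simp add: pos_le_divide_eq)
    qed
    moreover have "t * \<pi> / a \<le> 2 * P * t\<^sup>2"
    proof -
      have "P * t\<^sup>2 * 1 \<le> P * t\<^sup>2 * (2 * a)" using a P by (intro mult_left_mono) auto
      then show ?thesis using a t\<pi>' by (simp add: pos_divide_le_eq mult_ac)
    qed
    ultimately have "\<gamma> * (t\<^sup>2 / 2) \<le> \<gamma> * (t * \<pi> / a)" "\<gamma> * (t * \<pi> / a) \<le> \<gamma> * (2 * P * t\<^sup>2)"
      by - (rule mult_left_mono[OF _ \<gamma>0], assumption)+
    then show ?thesis unfolding wt by (simp add: mult_ac)
  qed
  have w0: "Re (w 0) = 0" by (simp add: w_def q_def V_def p_def)
  have v_le: "cmod (v t) \<le> 2 * k * cmod (u t)" if t: "\<bar>t\<bar> \<le> h" for t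
  proof -
    have "cmod (v t) \<le> cmod (v t - w t * u t) + cmod (w t * u t)"
      using norm_triangle_ineq[of "v t - w t * u t" "w t * u t"] by simp
    also have "cmod (w t * u t) \<le> k * (5 / 4) * cmod (u t)"
    proof -
      have "cmod (w t) \<le> k * (5 / 4)"
        unfolding w_def norm_mult using k0 q_upper[of "of_real t"] t by simp
      then show ?thesis unfolding norm_mult by (rule mult_right_mono) simp
    qed
    also have "cmod (v t - w t * u t) \<le> (k / 4) * cmod (u t)"
    proof -
      have "6 * P * cmod (u t) \<le> k / 4 * cmod (u t)" using k by (intro mult_right_mono) auto
      then show ?thesis using seg(1)[OF t] by linarith
    qed
    finally have "cmod (v t) \<le> (k / 4 + k * (5 / 4)) * cmod (u t)" by (simp add: algebra_simps)
    also have "\<dots> \<le> (2 * k) * cmod (u t)" using k0 by (intro mult_right_mono) auto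
    finally show ?thesis .
  qed
  have "u 0 \<noteq> 0" using seg(2)[of 0] h by auto
  moreover have "(cmod (u t))\<^sup>2 \<le> (cmod (u 0))\<^sup>2 * exp (- (\<gamma> / 2) * t\<^sup>2 + 2 * (6 * P) * \<bar>t\<bar>)"
    "(cmod (u t))\<^sup>2 \<ge> (cmod (u 0))\<^sup>2 * exp (- (2 * P * \<gamma>) * t\<^sup>2 - 2 * (6 * P) * \<bar>t\<bar>)" if "\<bar>t\<bar> \<le> h" for t
    by (rule gaussian_bounds[of h u v w "6 * P" "\<gamma> / 2" "2 * P * \<gamma>"]; use u' seg w w0 that in simp)+
  ultimately show ?thesis using u' v' v_le unfolding \<gamma>_def gaussian_solution_def by blast
qed

lemma model_equation_solution:
  assumes "j \<ge> 1"
  shows "\<exists>h P. 0 < h \<and> h \<le> 1 / 2 \<and> 1 \<le> P \<and>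
    (\<forall>k \<mu>. k \<ge> 24 * P \<longrightarrow> cmod \<mu> \<le> 1 \<longrightarrow> (\<exists>u v. gaussian_solution j h P k \<mu> u v))"
proof -
  obtain h P where hP: "0 < h" "h \<le> 1 / 2" "1 \<le> P" and near: "\<And>z :: complex. cmod z \<le> h \<Longrightarrow>
      cmod ((1 + z) ^ j - 1) \<le> 1 / 8 \<and> cmod (of_nat j * (1 + z) ^ (j - 1)) \<le> P \<and>
      cmod ((1 + z) ^ j - 1) \<le> P * cmod z"
    using monomial_perturbation_bounds[OF assms] by blast
  show ?thesis
  proof (rule exI[of _ h], rule exI[of _ P], intro conjI hP allI impI)
    fix k \<mu> assume 1: "24 * P \<le> k" "cmod \<mu> \<le> 1"
    show "\<exists>u v. gaussian_solution j h P k \<mu> u v"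
    proof (cases "Im \<mu> \<le> 0")
      case True
      show ?thesis
        by (rule model_equation_solution_nonpos[OF hP assms near 1 True])
    next
      case False
      then have "cmod (cnj \<mu>) \<le> 1" "Im (cnj \<mu>) \<le> 0" using 1 by auto
      from model_equation_solution_nonpos[OF hP assms near 1(1) this]
      obtain u v where uv: "gaussian_solution j h P k (cnj \<mu>) u v" by blast
      have "((\<lambda>t. cnj (u t)) has_vector_derivative cnj (v t)) (at t)" for t
        using uv unfolding gaussian_solution_def by (blast intro: has_vector_derivative_cnj)
      moreover have "((\<lambda>t. cnj (v t)) has_vector_derivative
          - (of_real (k\<^sup>2) * (1 - 2 * \<mu> * of_real ((1 + t) ^ j - 1))) * cnj (u t)) (at t)" for t
      proof -
        have "(v has_vector_derivative
            - (of_real (k\<^sup>2) * (1 - 2 * cnj \<mu> * of_real ((1 + t) ^ j - 1))) * u t) (at t)"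
          using uv unfolding gaussian_solution_def by blast
        from has_vector_derivative_cnj[OF this] show ?thesis by simp
      qed
      ultimately have "gaussian_solution j h P k \<mu> (\<lambda>t. cnj (u t)) (\<lambda>t. cnj (v t))"
        using uv unfolding gaussian_solution_def by simp
      then show ?thesis by blast
    qed
  qed
qed

section \<open>Algebras of smooth functions\<close>

text \<open>The unital complex algebra of functions generated by \<open>G\<close> under pointwise operations. If every
  generator has a derivative in the algebra, then the algebra is closed under differentiation and
  therefore consists of smooth functions; this is how smoothness is proved below.\<close>

inductive_set generated_algebra :: "(real \<Rightarrow> complex) set \<Rightarrow> (real \<Rightarrow> complex) set"
  for G where
  generator: "f \<in> G \<Longrightarrow> f \<in> generated_algebra G"
| const: "(\<lambda>x. c) \<in> generated_algebra G"
| add: "f \<in> generated_algebra G \<Longrightarrow> g \<in> generated_algebra G \<Longrightarrow> (\<lambda>x. f x + g x) \<in> generated_algebra G"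
| mult: "f \<in> generated_algebra G \<Longrightarrow> g \<in> generated_algebra G \<Longrightarrow> (\<lambda>x. f x * g x) \<in> generated_algebra G"

lemma generated_algebra_power:
  "f \<in> generated_algebra G \<Longrightarrow> (\<lambda>x. f x ^ n) \<in> generated_algebra G"
  by (induction n) (auto intro: generated_algebra.intros)

lemma generated_algebra_diff:
  assumes "f \<in> generated_algebra G" "g \<in> generated_algebra G"
  shows "(\<lambda>x. f x - g x) \<in> generated_algebra G"
  using generated_algebra.add[OF assms(1) generated_algebra.mult[OF generated_algebra.const[of "-1"] assms(2)]]
  by simp

lemma generated_algebra_has_derivative:
  assumes G: "\<And>g. g \<in> G \<Longrightarrow> \<exists>g' \<in> generated_algebra G. \<forall>x. (g has_vector_derivative g' x) (at x)"
    and f: "f \<in> generated_algebra G"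
  shows "\<exists>f' \<in> generated_algebra G. \<forall>x. (f has_vector_derivative f' x) (at x)"
  using f
proof induction
  case (generator f)
  then show ?case by (rule G)
next
  case (const c)
  then show ?case
    by (intro bexI[of _ "\<lambda>x. 0"]) (auto intro: generated_algebra.const)
next
  case (add f g)
  then obtain f' g' where
    *: "f' \<in> generated_algebra G" "\<And>x. (f has_vector_derivative f' x) (at x)"
    "g' \<in> generated_algebra G" "\<And>x. (g has_vector_derivative g' x) (at x)" by blast
  then show ?case
    by (intro bexI[of _ "\<lambda>x. f' x + g' x"])
      (auto intro: generated_algebra.add has_vector_derivative_add)
next
  case (mult f g)
  then obtain f' g' where
    *: "f' \<in> generated_algebra G" "\<And>x. (f has_vector_derivative f' x) (at x)"
    "g' \<in> generated_algebra G" "\<And>x. (g has_vector_derivative g' x) (at x)" by blast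
  then show ?case using mult.hyps
    by (intro bexI[of _ "\<lambda>x. f x * g' x + f' x * g x"])
      (auto intro: generated_algebra.intros has_vector_derivative_mult)
qed

lemma smooth_generated_algebra:
  assumes G: "\<And>g. g \<in> G \<Longrightarrow> \<exists>g' \<in> generated_algebra G. \<forall>x. (g has_vector_derivative g' x) (at x)"
    and f: "f \<in> generated_algebra G"
  shows "smooth f"
proof -
  have D: "D g \<in> generated_algebra G" if "g \<in> generated_algebra G" for g
  proof -
    obtain g' where g': "g' \<in> generated_algebra G" "\<And>x. (g has_vector_derivative g' x) (at x)"
      using generated_algebra_has_derivative[OF G \<open>g \<in> _\<close>] by blast
    then have "D g = g'" unfolding D_def by (auto intro: vector_derivative_at)
    then show ?thesis using g' by simp
  qed
  have "(D ^^ n) f \<in> generated_algebra G" for n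
    by (induction n) (use f D in auto)
  then show ?thesis
    unfolding smooth_def using generated_algebra_has_derivative[OF G] differentiableI_vector by blast
qed

lemma smooth_has_derivative:
  assumes "smooth f"
  shows "(f has_vector_derivative D f x) (at x)"
proof -
  have "(D ^^ 0) f differentiable at x" using assms unfolding smooth_def by blast
  then show ?thesis unfolding D_def by (simp add: vector_derivative_works)
qed

lemma D_eqI: "(\<And>x. (f has_vector_derivative f' x) (at x)) \<Longrightarrow> D f = f'"
  unfolding D_def by (auto intro: vector_derivative_at)

lemma smooth_D: "smooth f \<Longrightarrow> smooth (D f)"
  unfolding smooth_def funpow_swap1[symmetric] by (metis funpow.simps(2) o_apply funpow_swap1)

lemma smooth_if_in_generated_algebra:
  assumes "f \<in> generated_algebra {f. smooth f}"
  shows "smooth f"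
proof (rule smooth_generated_algebra[OF _ assms])
  fix g assume "g \<in> {f. smooth f}"
  then show "\<exists>g' \<in> generated_algebra {f. smooth f}. \<forall>x. (g has_vector_derivative g' x) (at x)"
    by (intro bexI[of _ "D g"]) (auto intro: generated_algebra.generator smooth_has_derivative smooth_D)
qed

lemma smooth_const: "smooth (\<lambda>x. c)"
  by (intro smooth_if_in_generated_algebra generated_algebra.const)

lemma smooth_mult: "smooth f \<Longrightarrow> smooth g \<Longrightarrow> smooth (\<lambda>x. f x * g x)"
  by (intro smooth_if_in_generated_algebra generated_algebra.mult) (auto intro: generated_algebra.generator)

lemma smooth_compose_affine:
  assumes "smooth f"
  shows "smooth (\<lambda>x. f (c * x + d))"
proof (rule smooth_generated_algebra[of "{\<lambda>x. f (c * x + d) |f. smooth f}"])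
  let ?G = "{\<lambda>x. f (c * x + d) |f. smooth f}"
  fix g assume "g \<in> ?G"
  then obtain f where f: "smooth f" "g = (\<lambda>x. f (c * x + d))" by blast
  have "((\<lambda>x. c * x + d) has_vector_derivative c) (at x)" for x
    by (auto intro!: derivative_eq_intros simp flip: has_real_derivative_iff_has_vector_derivative)
  from vector_diff_chain_at[OF this smooth_has_derivative[OF f(1)]]
  have "(g has_vector_derivative of_real c * D f (c * x + d)) (at x)" for x
    by (simp add: f(2) o_def scaleR_conv_of_real)
  moreover have "(\<lambda>x. of_real c * D f (c * x + d)) \<in> generated_algebra ?G"
    using smooth_D[OF f(1)]
    by (intro generated_algebra.mult[OF generated_algebra.const generated_algebra.generator]) blast
  ultimately show "\<exists>g' \<in> generated_algebra ?G. \<forall>x. (g has_vector_derivative g' x) (at x)"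
    by (intro bexI[of _ "\<lambda>x. of_real c * D f (c * x + d)"]) auto
qed (use assms in \<open>auto intro: generated_algebra.generator\<close>)

lemma D_compose_affine:
  assumes "smooth f"
  shows "D (\<lambda>x. f (c * x + d)) = (\<lambda>x. of_real c * D f (c * x + d))"
proof (rule D_eqI)
  fix x
  have "((\<lambda>x. c * x + d) has_vector_derivative c) (at x)"
    by (auto intro!: derivative_eq_intros simp flip: has_real_derivative_iff_has_vector_derivative)
  from vector_diff_chain_at[OF this smooth_has_derivative[OF assms]]
  show "((\<lambda>x. f (c * x + d)) has_vector_derivative of_real c * D f (c * x + d)) (at x)"
    by (simp add: o_def scaleR_conv_of_real)
qed

lemma D_cmult:
  assumes "smooth f"
  shows "D (\<lambda>x. c * f x) = (\<lambda>x. c * D f x)"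
  by (rule D_eqI) (use has_vector_derivative_mult[OF has_vector_derivative_const smooth_has_derivative[OF assms]] in simp)

lemma smooth_of_real: "smooth of_real"
proof (rule smooth_generated_algebra[of "{of_real}"])
  fix g :: "real \<Rightarrow> complex" assume "g \<in> {of_real}"
  then show "\<exists>g' \<in> generated_algebra {of_real}. \<forall>x. (g has_vector_derivative g' x) (at x)"
    by (intro bexI[of _ "\<lambda>x. 1"])
      (auto intro: generated_algebra.const has_vector_derivative_of_real[OF DERIV_ident, simplified])
qed (auto intro: generated_algebra.generator)

lemma continuous_smooth: "smooth f \<Longrightarrow> continuous_on S f"
  by (meson continuous_at_imp_continuous_on has_vector_derivative_continuous smooth_has_derivative)

lemma smooth_second_order_ode:
  assumes "\<And>t. (u has_vector_derivative v t) (at t)"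
    and "\<And>t. (v has_vector_derivative w t * u t) (at t)" and "smooth w"
  shows "smooth u"
proof (rule smooth_generated_algebra[of "insert u (insert v {f. smooth f})"])
  let ?G = "insert u (insert v {f. smooth f})"
  fix g assume "g \<in> ?G"
  then consider "g = u" | "g = v" | "smooth g" by blast
  then show "\<exists>g' \<in> generated_algebra ?G. \<forall>x. (g has_vector_derivative g' x) (at x)"
  proof cases
    case 1
    then show ?thesis using assms by (intro bexI[of _ v]) (auto intro: generated_algebra.generator)
  next
    case 2
    have "(\<lambda>t. w t * u t) \<in> generated_algebra ?G"
      using assms(3)
      by (intro generated_algebra.mult[OF generated_algebra.generator generated_algebra.generator]) auto
    then show ?thesis using 2 assms(2) by (intro bexI[of _ "\<lambda>t. w t * u t"]) auto
  next
    case 3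
    then show ?thesis
      by (intro bexI[of _ "D g"]) (auto intro: generated_algebra.generator smooth_has_derivative smooth_D)
  qed
qed (auto intro: generated_algebra.generator)

section \<open>A smooth cutoff\<close>

text \<open>The functions \<open>x\<^sup>-\<^sup>k exp(-1/x)\<close>, extended by \<open>0\<close> to \<open>x \<le> 0\<close>. Differentiation only
  produces combinations of functions of this family with larger \<open>k\<close>.\<close>

definition flat_exp :: "nat \<Rightarrow> real \<Rightarrow> real" where
  "flat_exp k x = (if x > 0 then (1 / x) ^ k * exp (- (1 / x)) else 0)"

lemma flat_exp_nonneg: "flat_exp k x \<ge> 0"
  by (simp add: flat_exp_def)

lemma flat_exp_eq_0: "x \<le> 0 \<Longrightarrow> flat_exp k x = 0"
  by (simp add: flat_exp_def)

lemma flat_exp_pos: "x > 0 \<Longrightarrow> flat_exp k x > 0"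
  by (simp add: flat_exp_def)

lemma flat_exp_mono: "x \<le> y \<Longrightarrow> flat_exp 0 x \<le> flat_exp 0 y"
  by (auto simp: flat_exp_def field_simps)

lemma power_le_fact_exp:
  fixes y :: real
  assumes "y \<ge> 0"
  shows "y ^ n \<le> fact n * exp y"
proof -
  have "(\<Sum>i\<in>{n}. y ^ i /\<^sub>R fact i) \<le> exp y"
    unfolding exp_def using assms by (intro sum_le_suminf summable_exp_generic) auto
  then show ?thesis by (simp add: field_simps)
qed

lemma flat_exp_le_square: "flat_exp k x \<le> fact (k + 2) * x\<^sup>2"
proof (cases "x > 0")
  case True
  define y where "y = 1 / x"
  have y: "y > 0" "x = 1 / y" using True by (auto simp: y_def)
  define c :: real where "c = fact (k + 2)"
  have "y ^ (k + 2) \<le> c * exp y" unfolding c_def using y by (intro power_le_fact_exp) auto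
  then have "y ^ k * exp (- y) \<le> c * (1 / y)\<^sup>2"
    using y by (simp add: exp_minus field_simps power_add power2_eq_square)
  then show ?thesis using True y by (simp add: flat_exp_def c_def)
qed (simp add: flat_exp_def)

lemma flat_exp_has_derivative:
  "(flat_exp k has_real_derivative flat_exp (k + 2) x - of_nat k * flat_exp (k + 1) x) (at x)"
proof -
  consider "x > 0" | "x < 0" | "x = 0" by linarith
  then show ?thesis
  proof cases
    case 1
    define y where "y = 1 / x"
    have y': "((\<lambda>x. 1 / x) has_real_derivative - (y\<^sup>2)) (at x)"
      using 1 by (auto intro!: derivative_eq_intros simp: y_def power2_eq_square)
    have "((\<lambda>x. (1 / x) ^ k * exp (- (1 / x))) has_real_derivative
        (of_nat k * (- (y\<^sup>2) * y ^ (k - 1))) * exp (- y) + y ^ k * (exp (- y) * y\<^sup>2)) (at x)"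
      by (rule derivative_eq_intros y' refl)+ (simp add: y_def)
    also have "(of_nat k * (- (y\<^sup>2) * y ^ (k - 1))) * exp (- y) + y ^ k * (exp (- y) * y\<^sup>2)
        = flat_exp (k + 2) x - of_nat k * flat_exp (k + 1) x"
      using 1 by (cases k) (simp_all add: flat_exp_def power2_eq_square flip: y_def)
    finally show ?thesis
      by (rule has_field_derivative_transform_within_open[of _ _ _ "{0<..}"])
        (use 1 in \<open>auto simp: flat_exp_def\<close>)
  next
    case 2
    have "((\<lambda>x. 0) has_real_derivative flat_exp (k + 2) x - of_nat k * flat_exp (k + 1) x) (at x)"
      using 2 by (simp add: flat_exp_def)
    then show ?thesis
      by (rule has_field_derivative_transform_within_open[of _ _ _ "{..<0}"])
        (use 2 in \<open>auto simp: flat_exp_def\<close>)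
  next
    case 3
    have "((\<lambda>h. (flat_exp k (0 + h) - flat_exp k 0) / h) \<longlongrightarrow> 0) (at 0)"
    proof (rule Lim_null_comparison)
      show "\<forall>\<^sub>F h in at 0. norm ((flat_exp k (0 + h) - flat_exp k 0) / h) \<le> fact (k + 2) * \<bar>h\<bar>"
      proof (rule eventually_at_filter[THEN iffD2], rule always_eventually, intro allI impI)
        fix h :: real assume "h \<noteq> 0"
        have "norm ((flat_exp k (0 + h) - flat_exp k 0) / h) = flat_exp k h / \<bar>h\<bar>"
          by (simp add: flat_exp_eq_0 flat_exp_nonneg)
        also have "\<dots> \<le> fact (k + 2) * h\<^sup>2 / \<bar>h\<bar>"
          by (intro divide_right_mono flat_exp_le_square) auto
        also have "\<dots> = fact (k + 2) * \<bar>h\<bar>" 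
          by (cases "h \<ge> 0") (simp_all add: power2_eq_square)
        finally show "norm ((flat_exp k (0 + h) - flat_exp k 0) / h) \<le> fact (k + 2) * \<bar>h\<bar>" .
      qed
      show "((\<lambda>h. fact (k + 2) * \<bar>h\<bar>) \<longlongrightarrow> 0) (at (0::real))"
        by (rule tendsto_eq_intros refl | simp)+
    qed
    then show ?thesis using 3 by (simp add: DERIV_def flat_exp_def)
  qed
qed

lemma smooth_flat_exp_compose:
  assumes g: "smooth (\<lambda>x. of_real (g x))"
  shows "smooth (\<lambda>x. of_real (flat_exp k (g x)))"
proof -
  define H where "H = {f. smooth f} \<union> (\<lambda>k x. of_real (flat_exp k (g x))) ` UNIV"
  have g': "(g has_real_derivative Re (D (\<lambda>x. of_real (g x)) x)) (at x)" for x
    using bounded_linear.has_vector_derivative[OF bounded_linear_Re smooth_has_derivative[OF g]]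
    by (simp add: has_real_derivative_iff_has_vector_derivative)
  have Dg: "D (\<lambda>x. of_real (g x)) x = of_real (Re (D (\<lambda>x. of_real (g x)) x))" for x
    using vector_derivative_unique_at[OF smooth_has_derivative[OF g] has_vector_derivative_of_real[OF g'[of x]]]
    by simp
  show ?thesis
  proof (rule smooth_generated_algebra[of H])
    fix f assume "f \<in> H"
    then consider "smooth f" | k where "f = (\<lambda>x. of_real (flat_exp k (g x)))"
      unfolding H_def by blast
    then show "\<exists>f' \<in> generated_algebra H. \<forall>x. (f has_vector_derivative f' x) (at x)"
    proof cases
      case 1
      then show ?thesis
        by (intro bexI[of _ "D f"])
          (auto simp: H_def intro: generated_algebra.generator smooth_has_derivative smooth_D)
    next
      case 2
      have "((\<lambda>x. flat_exp k (g x)) has_real_derivative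
          (flat_exp (k + 2) (g x) - of_nat k * flat_exp (k + 1) (g x)) * Re (D (\<lambda>x. of_real (g x)) x)) (at x)" for x
        by (rule DERIV_chain2[OF flat_exp_has_derivative g'])
      from has_vector_derivative_of_real[OF this]
      have "(f has_vector_derivative
          (of_real (flat_exp (k + 2) (g x)) - of_nat k * of_real (flat_exp (k + 1) (g x)))
            * D (\<lambda>x. of_real (g x)) x) (at x)" for x
        unfolding 2 by (subst Dg) simp
      then show ?thesis using smooth_D[OF g]
        by (intro bexI[of _ "\<lambda>x. (of_real (flat_exp (k + 2) (g x)) - of_nat k * of_real (flat_exp (k + 1) (g x)))
            * D (\<lambda>x. of_real (g x)) x"])
          (auto simp: H_def intro!: generated_algebra.mult generated_algebra_diff generated_algebra.const
            intro: generated_algebra.generator)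
    qed
  qed (auto simp: H_def intro: generated_algebra.generator)
qed

lemma D_eq_0_locally_const:
  assumes "open S" "x \<in> S" "\<And>y. y \<in> S \<Longrightarrow> f y = c"
  shows "D f x = 0"
proof -
  have "(f has_vector_derivative 0) (at x)"
    by (rule has_vector_derivative_transform_within_open[OF has_vector_derivative_const[of c]])
      (use assms in auto)
  then show ?thesis unfolding D_def by (rule vector_derivative_at)
qed

text \<open>With \<open>e\<close> denoting \<^term>\<open>flat_exp 0\<close> and \<open>b > 0\<close> a constant, the cutoff is a multiple of
  \<open>e(1 - e(t\<^sup>2 - (h/2)\<^sup>2)/b)\<close>. The inner function vanishes for \<open>\<bar>t\<bar> \<le> h/2\<close>, which gives the
  plateau, and it is at least \<open>b\<close> for \<open>\<bar>t\<bar> \<ge> h\<close>, where the outer function vanishes.\<close>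

lemma cutoff_exists:
  assumes h: "h > 0"
  shows "\<exists>\<phi> X. smooth \<phi> \<and> X > 0 \<and> (\<forall>t. \<bar>t\<bar> \<le> h / 2 \<longrightarrow> \<phi> t = 1) \<and> (\<forall>t. \<bar>t\<bar> \<ge> h \<longrightarrow> \<phi> t = 0) \<and>
    (\<forall>t. cmod (D \<phi> t) \<le> X \<and> cmod (D (D \<phi>) t) \<le> X) \<and>
    (\<forall>t. \<bar>t\<bar> < h / 2 \<or> \<bar>t\<bar> > h \<longrightarrow> D \<phi> t = 0 \<and> D (D \<phi>) t = 0)"
proof -
  define b where "b = flat_exp 0 (h\<^sup>2 - (h / 2)\<^sup>2)"
  have b: "b > 0" unfolding b_def using h by (intro flat_exp_pos) (simp add: power_divide)
  define g where "g t = 1 - flat_exp 0 (t\<^sup>2 - (h / 2)\<^sup>2) / b" for t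
  define \<phi> :: "real \<Rightarrow> complex" where "\<phi> t = of_real (exp 1) * of_real (flat_exp 0 (g t))" for t
  have s1: "smooth (\<lambda>t. of_real (t\<^sup>2 - (h / 2)\<^sup>2))"
    unfolding of_real_diff of_real_power
    by (intro smooth_if_in_generated_algebra generated_algebra_diff generated_algebra_power generated_algebra.const)
      (auto intro!: generated_algebra.generator smooth_of_real)
  have s2: "smooth (\<lambda>t. of_real (g t))"
  proof -
    have "(\<lambda>t. of_real (g t)) = (\<lambda>t. 1 - of_real (flat_exp 0 (t\<^sup>2 - (h / 2)\<^sup>2)) * complex_of_real (1 / b))"
      by (simp add: g_def fun_eq_iff)
    moreover have "smooth (\<lambda>t. 1 - of_real (flat_exp 0 (t\<^sup>2 - (h / 2)\<^sup>2)) * complex_of_real (1 / b))"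
      by (intro smooth_if_in_generated_algebra generated_algebra_diff generated_algebra.mult generated_algebra.const)
        (auto intro!: generated_algebra.generator smooth_flat_exp_compose s1)
    ultimately show ?thesis by simp
  qed
  have s: "smooth \<phi>"
    unfolding \<phi>_def by (intro smooth_mult smooth_const smooth_flat_exp_compose s2)
  have one: "\<phi> t = 1" if "\<bar>t\<bar> \<le> h / 2" for t
  proof -
    have "t\<^sup>2 \<le> (h / 2)\<^sup>2" using power_mono[OF that, of 2] by simp
    then have "g t = 1" by (simp add: g_def flat_exp_eq_0)
    then show ?thesis by (simp add: \<phi>_def flat_exp_def exp_minus flip: of_real_mult)
  qed
  have zero: "\<phi> t = 0" if "\<bar>t\<bar> \<ge> h" for t
  proof -
    have "h\<^sup>2 \<le> t\<^sup>2" using power_mono[OF that, of 2] h by simp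
    then have "b \<le> flat_exp 0 (t\<^sup>2 - (h / 2)\<^sup>2)" unfolding b_def by (intro flat_exp_mono) simp
    then have "g t \<le> 0" using b by (simp add: g_def)
    then show ?thesis by (simp add: \<phi>_def flat_exp_eq_0)
  qed
  have in0: "D \<phi> t = 0" if "\<bar>t\<bar> < h / 2" for t
    by (rule D_eq_0_locally_const[of "{- (h/2)<..<h/2}" _ _ 1]) (use that one in auto)
  have out0: "D \<phi> t = 0" if "\<bar>t\<bar> > h" for t
    by (rule D_eq_0_locally_const[of "{..<- h} \<union> {h<..}" _ _ 0]) (use that zero h in auto)
  have in1: "D (D \<phi>) t = 0" if "\<bar>t\<bar> < h / 2" for t
    by (rule D_eq_0_locally_const[of "{- (h/2)<..<h/2}" _ _ 0]) (use that in0 in auto)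
  have out1: "D (D \<phi>) t = 0" if "\<bar>t\<bar> > h" for t
    by (rule D_eq_0_locally_const[of "{..<- h} \<union> {h<..}" _ _ 0]) (use that out0 h in auto)
  have "bounded (D \<phi> ` {-h..h})" "bounded (D (D \<phi>) ` {-h..h})"
    by (intro compact_imp_bounded compact_continuous_image continuous_smooth smooth_D s compact_Icc)+
  then obtain X1 X2 where X: "\<And>t. t \<in> {-h..h} \<Longrightarrow> cmod (D \<phi> t) \<le> X1"
    "\<And>t. t \<in> {-h..h} \<Longrightarrow> cmod (D (D \<phi>) t) \<le> X2"
    unfolding bounded_iff by blast
  define X where "X = max 1 (max X1 X2)"
  have "cmod (D \<phi> t) \<le> X \<and> cmod (D (D \<phi>) t) \<le> X" for t
  proof (cases "\<bar>t\<bar> > h")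
    case False
    then have "t \<in> {-h..h}" by auto
    then show ?thesis using X[of t] by (auto simp: X_def)
  qed (simp add: out0 out1 X_def)
  then show ?thesis using s one zero in0 in1 out0 out1
    by (intro exI[of _ \<phi>] exI[of _ X]) (auto simp: X_def)
qed

section \<open>Quasimodes of the model equation\<close>

text \<open>A cut-off exact solution \<open>f\<close>. The constant \<open>F\<close> normalizes it: \<open>\<bar>f\<bar>\<^sup>2 \<ge> F\<close> on \<open>[0, \<tau>]\<close>, whereas
  the squared residual is pointwise at most \<open>F\<close> times \<open>C k\<^sup>2 exp(-c k\<bar>Im \<mu>\<bar>)\<close>. Both hold with constants
  that are uniform in \<open>k\<close> and \<open>\<mu>\<close>.\<close>

lemma model_quasimode:
  assumes j: "j \<ge> 1"
  obtains h \<tau> c C K :: real where "0 < h" "0 < \<tau>" "0 < c" "0 < C" "0 < K"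
    "\<forall>k \<mu>. k \<ge> K \<longrightarrow> cmod \<mu> \<le> 1 \<longrightarrow>
      (\<exists>f F. smooth f \<and> (\<forall>t. \<bar>t\<bar> > h \<longrightarrow> f t = 0) \<and> 0 < F \<and>
        (\<forall>t. 0 \<le> t \<longrightarrow> t \<le> \<tau> \<longrightarrow> F \<le> (cmod (f t))\<^sup>2) \<and>
        (\<forall>t. (cmod (D (D f) t + of_real (k\<^sup>2) * (1 - 2 * \<mu> * of_real ((1 + t) ^ j - 1)) * f t))\<^sup>2
          \<le> C * k\<^sup>2 * exp (- c * (k * \<bar>Im \<mu>\<bar>)) * F * indicator {-h..h} t))"
proof -
  obtain h P where h: "0 < h" "h \<le> 1 / 2" and P: "1 \<le> P"
    and sol: "\<And>k \<mu>. k \<ge> 24 * P \<Longrightarrow> cmod \<mu> \<le> 1 \<Longrightarrow> \<exists>u v. gaussian_solution j h P k \<mu> u v"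
    using model_equation_solution[OF j] by metis
  obtain \<phi> X where \<phi>: "smooth \<phi>" "X > 0" "\<And>t. \<bar>t\<bar> \<le> h / 2 \<Longrightarrow> \<phi> t = 1" "\<And>t. \<bar>t\<bar> \<ge> h \<Longrightarrow> \<phi> t = 0"
    "\<And>t. cmod (D \<phi> t) \<le> X" "\<And>t. cmod (D (D \<phi>) t) \<le> X"
    "\<And>t. \<bar>t\<bar> < h / 2 \<or> \<bar>t\<bar> > h \<Longrightarrow> D \<phi> t = 0 \<and> D (D \<phi>) t = 0"
    using cutoff_exists[OF h(1)] by metis
  \<comment> \<open>On \<open>[0, \<tau>]\<close> the Gaussian term \<open>2P\<gamma>t\<^sup>2\<close> of the exponent is at most \<open>\<gamma>h\<^sup>2/16\<close>,
    half of the lower bound \<open>\<gamma>h\<^sup>2/8\<close> for \<open>\<gamma>t\<^sup>2/2\<close> where the cutoff varies.\<close>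
  define \<tau> where "\<tau> = h / (6 * P)"
  have \<tau>: "0 < \<tau>" "\<tau> \<le> h / 2" using h P by (auto simp: \<tau>_def field_simps)
  have \<tau>2: "2 * P * \<tau>\<^sup>2 \<le> h\<^sup>2 / 16"
  proof -
    have "2 * P * \<tau>\<^sup>2 = h\<^sup>2 / (18 * P)" using P by (simp add: \<tau>_def power_divide power2_eq_square field_simps)
    also have "\<dots> \<le> h\<^sup>2 / 16" using P by (intro divide_left_mono) auto
    finally show ?thesis .
  qed
  define C where "C = 25 * X\<^sup>2 * exp (24 * P * h)"
  have C: "C > 0" using \<phi>(2) by (simp add: C_def)
  have main: "\<exists>f F. smooth f \<and> (\<forall>t. \<bar>t\<bar> > h \<longrightarrow> f t = 0) \<and> 0 < F \<and>
      (\<forall>t. 0 \<le> t \<longrightarrow> t \<le> \<tau> \<longrightarrow> F \<le> (cmod (f t))\<^sup>2) \<and>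
      (\<forall>t. (cmod (D (D f) t + of_real (k\<^sup>2) * (1 - 2 * \<mu> * of_real ((1 + t) ^ j - 1)) * f t))\<^sup>2
        \<le> C * k\<^sup>2 * exp (- (h\<^sup>2 / 16) * (k * \<bar>Im \<mu>\<bar>)) * F * indicator {-h..h} t)"
    if k: "k \<ge> 24 * P" and \<mu>: "cmod \<mu> \<le> 1" for k \<mu>
  proof -
    define \<gamma> where "\<gamma> = k * \<bar>Im \<mu>\<bar>"
    define V where "V t = of_real (k\<^sup>2) * (1 - 2 * \<mu> * of_real ((1 + t) ^ j - 1))" for t :: real
    have k1: "k \<ge> 1" using k P by linarith
    have \<gamma>0: "\<gamma> \<ge> 0" using k1 by (simp add: \<gamma>_def)
    obtain u v where u: "\<And>t. (u has_vector_derivative v t) (at t)"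
      and v: "\<And>t. (v has_vector_derivative - V t * u t) (at t)"
      and u0: "u 0 \<noteq> 0"
      and vu: "\<And>t. \<bar>t\<bar> \<le> h \<Longrightarrow> cmod (v t) \<le> 2 * k * cmod (u t)"
      and u_upper: "\<And>t. \<bar>t\<bar> \<le> h \<Longrightarrow>
        (cmod (u t))\<^sup>2 \<le> (cmod (u 0))\<^sup>2 * exp (- (\<gamma> / 2) * t\<^sup>2 + 2 * (6 * P) * \<bar>t\<bar>)"
      and u_lower: "\<And>t. \<bar>t\<bar> \<le> h \<Longrightarrow>
        (cmod (u t))\<^sup>2 \<ge> (cmod (u 0))\<^sup>2 * exp (- (2 * P * \<gamma>) * t\<^sup>2 - 2 * (6 * P) * \<bar>t\<bar>)"
      using sol[OF k \<mu>] unfolding \<gamma>_def V_def gaussian_solution_def by metis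
    have "smooth (\<lambda>t. - V t)"
    proof -
      have "(\<lambda>t. of_real (- (k\<^sup>2)) * (1 - 2 * \<mu> * ((1 + of_real t) ^ j - 1)))
          \<in> generated_algebra {f. smooth f}"
        by (intro generated_algebra.mult generated_algebra_diff generated_algebra_power
            generated_algebra.add generated_algebra.const generated_algebra.generator[of of_real])
          (simp add: smooth_of_real)
      then have "smooth (\<lambda>t. of_real (- (k\<^sup>2)) * (1 - 2 * \<mu> * ((1 + of_real t) ^ j - 1)))"
        by (rule smooth_if_in_generated_algebra)
      then show ?thesis by (simp add: V_def)
    qed
    then have su: "smooth u" using smooth_second_order_ode[OF u v] by blast
    define f where "f t = \<phi> t * u t" for t
    have sf: "smooth f" unfolding f_def by (rule smooth_mult[OF \<phi>(1) su])
    note d\<phi> = smooth_has_derivative[OF \<phi>(1)] and dd\<phi> = smooth_has_derivative[OF smooth_D[OF \<phi>(1)]]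
    have Df: "D f = (\<lambda>t. \<phi> t * v t + D \<phi> t * u t)"
      unfolding f_def by (rule D_eqI) (rule has_vector_derivative_mult[OF d\<phi> u])
    have "D (D f) t = \<phi> t * (- V t * u t) + D \<phi> t * v t + (D \<phi> t * v t + D (D \<phi>) t * u t)" for t
      unfolding Df
      by (subst D_eqI[of _ "\<lambda>t. \<phi> t * (- V t * u t) + D \<phi> t * v t + (D \<phi> t * v t + D (D \<phi>) t * u t)"])
        (intro has_vector_derivative_add has_vector_derivative_mult d\<phi> dd\<phi> u v refl)+
    then have res: "D (D f) t + V t * f t = D (D \<phi>) t * u t + 2 * D \<phi> t * v t" for t
      by (simp add: f_def algebra_simps)
    define n where "n = (cmod (u 0))\<^sup>2"
    have n: "n > 0" using u0 by (simp add: n_def)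
    define F where "F = n * exp (- (h\<^sup>2 / 16) * \<gamma> - 12 * P * h)"
    have F: "F > 0" using n by (simp add: F_def)
    have lower: "F \<le> (cmod (f t))\<^sup>2" if t: "0 \<le> t" "t \<le> \<tau>" for t
    proof -
      have "2 * P * t\<^sup>2 \<le> 2 * P * \<tau>\<^sup>2" using t P by (intro mult_left_mono power_mono) auto
      then have "2 * P * t\<^sup>2 \<le> h\<^sup>2 / 16" using \<tau>2 by linarith
      from mult_right_mono[OF this \<gamma>0] have "(2 * P * \<gamma>) * t\<^sup>2 \<le> (h\<^sup>2 / 16) * \<gamma>"
        by (simp add: mult_ac)
      moreover have "12 * P * t \<le> 12 * P * h" using t \<tau> P h by (intro mult_left_mono) auto
      ultimately have "F \<le> n * exp (- (2 * P * \<gamma>) * t\<^sup>2 - 2 * (6 * P) * \<bar>t\<bar>)"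
        unfolding F_def using n t by (intro mult_left_mono) auto
      also have "\<dots> \<le> (cmod (u t))\<^sup>2" unfolding n_def using t \<tau> h by (intro u_lower) auto
      also have "u t = f t" using t \<tau> by (simp add: f_def \<phi>(3))
      finally show ?thesis .
    qed
    have upper: "(cmod (D (D f) t + V t * f t))\<^sup>2
        \<le> C * k\<^sup>2 * exp (- (h\<^sup>2 / 16) * \<gamma>) * F * indicator {-h..h} t" for t
    proof (cases "\<bar>t\<bar> < h / 2 \<or> \<bar>t\<bar> > h")
      case True
      then have "D (D f) t + V t * f t = 0" unfolding res using \<phi>(7) by simp
      then show ?thesis using C F by simp
    next
      case False
      then have t: "h / 2 \<le> \<bar>t\<bar>" "\<bar>t\<bar> \<le> h" by auto
      have "cmod (D (D f) t + V t * f t) \<le> cmod (D (D \<phi>) t) * cmod (u t) + 2 * cmod (D \<phi> t) * cmod (v t)"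
        unfolding res by (rule order.trans[OF norm_triangle_ineq]) (simp add: norm_mult)
      also have "\<dots> \<le> X * cmod (u t) + 2 * X * (2 * k * cmod (u t))"
        using \<phi>(2,5,6) vu[OF t(2)] by (intro add_mono mult_mono) auto
      also have "\<dots> = X * ((1 + 4 * k) * cmod (u t))" by (simp add: algebra_simps)
      also have "\<dots> \<le> X * ((5 * k) * cmod (u t))"
        using k1 \<phi>(2) by (intro mult_left_mono mult_right_mono) auto
      finally have "cmod (D (D f) t + V t * f t) \<le> 5 * X * k * cmod (u t)" by (simp add: mult_ac)
      from power_mono[OF this, of 2]
      have "(cmod (D (D f) t + V t * f t))\<^sup>2 \<le> 25 * X\<^sup>2 * k\<^sup>2 * (cmod (u t))\<^sup>2"
        by (simp add: power_mult_distrib)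
      also have "(cmod (u t))\<^sup>2 \<le> exp (24 * P * h) * exp (- (h\<^sup>2 / 16) * \<gamma>) * F"
      proof -
        have "(h / 2)\<^sup>2 \<le> \<bar>t\<bar>\<^sup>2" using t h by (intro power_mono) auto
        from mult_right_mono[OF this \<gamma>0] have "h\<^sup>2 / 8 * \<gamma> \<le> (\<gamma> / 2) * t\<^sup>2"
          by (simp add: power_divide mult_ac)
        moreover have "12 * P * \<bar>t\<bar> \<le> 12 * P * h" using t P by (intro mult_left_mono) auto
        ultimately have "- (\<gamma> / 2) * t\<^sup>2 + 2 * (6 * P) * \<bar>t\<bar> \<le> 12 * P * h - h\<^sup>2 / 8 * \<gamma>"
          by linarith
        then have "n * exp (- (\<gamma> / 2) * t\<^sup>2 + 2 * (6 * P) * \<bar>t\<bar>) \<le> n * exp (12 * P * h - h\<^sup>2 / 8 * \<gamma>)"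
          using n by (intro mult_left_mono) auto
        also have "\<dots> = exp (24 * P * h) * exp (- (h\<^sup>2 / 16) * \<gamma>) * F"
          by (simp add: F_def flip: exp_add)
        finally show ?thesis using u_upper[OF t(2)] unfolding n_def by linarith
      qed
      finally have "(cmod (D (D f) t + V t * f t))\<^sup>2
          \<le> 25 * X\<^sup>2 * k\<^sup>2 * (exp (24 * P * h) * exp (- (h\<^sup>2 / 16) * \<gamma>) * F)"
        by (simp add: mult_left_mono)
      moreover have "t \<in> {-h..h}" using t by auto
      ultimately show ?thesis by (simp add: C_def mult_ac)
    qed
    have "\<forall>t. \<bar>t\<bar> > h \<longrightarrow> f t = 0" by (simp add: f_def \<phi>(4))
    then show ?thesis using sf F lower upper unfolding V_def \<gamma>_def by blast
  qed
  show ?thesis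
    by (rule that[of h \<tau> "h\<^sup>2 / 16" C "24 * P"]) (use h \<tau> C P main in auto)
qed

section \<open>Pseudomodes of the damped wave generator\<close>

lemma exp_decay_powr:
  fixes c \<delta> :: real
  assumes c: "c > 0" and \<delta>: "\<delta> > 0"
  shows "\<exists>C > 0. \<forall>a \<ge> 1. exp (- c * a powr \<delta>) \<le> C * a powr (- real N)"
proof -
  obtain n :: nat where n: "real N / \<delta> \<le> real n" using real_arch_simple by blast
  define C where "C = fact n / c ^ n"
  have C: "C > 0" using c by (simp add: C_def)
  have "exp (- c * a powr \<delta>) \<le> C * a powr (- real N)" if a: "a \<ge> 1" for a
  proof -
    have "(c * a powr \<delta>) ^ n \<le> fact n * exp (c * a powr \<delta>)"
      using c by (intro power_le_fact_exp) auto
    moreover have "(c * a powr \<delta>) ^ n = c ^ n * a powr (\<delta> * real n)"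
      using a by (simp add: power_mult_distrib powr_powr flip: powr_realpow)
    moreover have "a powr (real N) \<le> a powr (\<delta> * real n)"
      using a n \<delta> by (intro powr_mono) (auto simp: field_simps)
    ultimately have "c ^ n * a powr (real N) \<le> fact n * exp (c * a powr \<delta>)"
      using c by (smt (verit) mult_left_mono zero_le_power)
    then have "a powr (real N) \<le> C * exp (c * a powr \<delta>)"
      using c by (simp add: C_def field_simps)
    then show ?thesis
      using a by (simp add: exp_minus powr_minus field_simps)
  qed
  then show ?thesis using C by blast
qed

lemma L2norm_power2: "(L2norm f)\<^sup>2 = (LINT x|lborel. (cmod (f x))\<^sup>2)"
  unfolding L2norm_def by (intro real_sqrt_pow2 integral_nonneg) auto

lemma L2norm_power2_le:
  assumes "\<And>x. (cmod (f x))\<^sup>2 \<le> B * indicator {a..b} x" "a \<le> b" "B \<ge> 0"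
  shows "(L2norm f)\<^sup>2 \<le> B * (b - a)"
proof -
  have "(LINT x|lborel. (cmod (f x))\<^sup>2) \<le> (LINT x|lborel. B * indicator {a..b} x)"
    using assms by (intro integral_mono') auto
  also have "\<dots> = B * (b - a)" using assms by simp
  finally show ?thesis by (simp add: L2norm_power2)
qed

lemma L2norm_power2_ge:
  assumes "continuous_on UNIV f" "\<And>x. x \<notin> {a'..b'} \<Longrightarrow> f x = 0"
    and "\<And>x. x \<in> {a..b} \<Longrightarrow> B \<le> (cmod (f x))\<^sup>2" "a \<le> b"
  shows "B * (b - a) \<le> (L2norm f)\<^sup>2"
proof -
  have "integrable lborel (\<lambda>x. indicator {a'..b'} x *\<^sub>R (cmod (f x))\<^sup>2)"
    by (intro borel_integrable_compact continuous_intros continuous_on_subset[OF assms(1)]) auto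
  also have "(\<lambda>x. indicator {a'..b'} x *\<^sub>R (cmod (f x))\<^sup>2) = (\<lambda>x. (cmod (f x))\<^sup>2)"
    using assms(2) by (auto simp: fun_eq_iff indicator_def)
  finally have int: "integrable lborel (\<lambda>x. (cmod (f x))\<^sup>2)" .
  have "B * (b - a) = (LINT x|lborel. B * indicator {a..b} x)" using assms by simp
  also have "\<dots> \<le> (LINT x|lborel. (cmod (f x))\<^sup>2)"
  proof (rule integral_mono[OF _ int])
    show "integrable lborel (\<lambda>x. B * indicator {a..b} x)" using assms(4) by simp
    show "B * indicator {a..b} x \<le> (cmod (f x))\<^sup>2" for x
      using assms(3)[of x] by (simp add: indicator_def)
  qed
  finally show ?thesis by (simp add: L2norm_power2)
qed

lemma test_functionI:
  assumes "smooth f" "\<And>x. x \<notin> {a..b} \<Longrightarrow> f x = 0"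
  shows "f \<in> test_functions"
proof -
  have "bounded {x. f x \<noteq> 0}"
    by (rule bounded_subset[of "{a..b}"], simp, use assms(2) in blast)
  then show ?thesis using assms(1) by (simp add: test_functions_def)
qed

text \<open>For pairs \<open>(\<psi>, l\<psi>)\<close> the first component of the image vanishes, and the norm reduces to that of a
  second-order expression in \<open>\<psi>\<close>.\<close>

lemma Hnorm_generator_minus:
  "Hnorm (\<lambda>x. 0) (generator_minus (\<lambda>x. 0) a l (\<psi>, \<lambda>x. l * \<psi> x))
    = L2norm (\<lambda>x. D (D \<psi>) x - l * (l + 2 * of_real (a x)) * \<psi> x)"
proof -
  have "D (\<lambda>x. 0) = (\<lambda>x. 0)" by (rule D_eqI) simp
  moreover have "L2norm f \<ge> 0" for f
    unfolding L2norm_def by (intro real_sqrt_ge_zero integral_nonneg) auto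
  moreover have "L2norm (\<lambda>x. 0) = 0" by (simp add: L2norm_def)
  moreover have "(\<lambda>x. D (D \<psi>) x - 2 * of_real (a x) * (l * \<psi> x) - l * (l * \<psi> x))
      = (\<lambda>x. D (D \<psi>) x - l * (l + 2 * of_real (a x)) * \<psi> x)"
    by (simp add: fun_eq_iff algebra_simps)
  ultimately show ?thesis
    by (simp add: Hnorm_def generator_minus_def generator_def)
qed

lemma Hnorm_ge: "Hnorm q (\<psi>, \<lambda>x. l * \<psi> x) \<ge> cmod l * L2norm \<psi>"
proof -
  have "(L2norm (\<lambda>x. l * \<psi> x))\<^sup>2 = (cmod l * L2norm \<psi>)\<^sup>2"
    by (simp add: L2norm_power2 power_mult_distrib norm_mult)
  then show ?thesis unfolding Hnorm_def by (intro real_le_rsqrt) simp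
qed

text \<open>The left-hand side is the Gaussian rate \<open>k\<bar>Im \<mu>\<bar>\<close> in terms of \<open>l\<close>. For \<open>\<bar>Im l\<bar> \<le> a\<close> it is at
  least half of the power of \<open>a\<close> with exponent \<open>\<epsilon>\<close> by hypothesis; for larger \<open>\<bar>Im l\<bar>\<close> it is at least
  \<open>a/2\<close>.\<close>

lemma Gaussian_rate_lower_bound:
  fixes m :: nat and \<epsilon> a :: real
  assumes a: "a \<ge> 1" "Re l = - a"
    and \<beta>: "\<bar>Im l\<bar> \<ge> a powr (- 1 / (2 * real m) + \<epsilon>)"
  shows "a powr (1 / (2 * real m)) * (a * \<bar>Im l\<bar> / cmod l) \<ge> a powr (min \<epsilon> 1) / 2"
proof -
  define r where "r = a powr (1 / (2 * real m))"
  have r: "r \<ge> 1" unfolding r_def using a by (intro ge_one_powr_ge_zero) auto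
  have l0: "cmod l > 0" using a by auto
  have l: "cmod l \<le> a + \<bar>Im l\<bar>" using cmod_le[of l] a by simp
  have "a powr (min \<epsilon> 1) / 2 \<le> r * (a * \<bar>Im l\<bar> / cmod l)"
  proof (cases "\<bar>Im l\<bar> \<le> a")
    case True
    have "a powr (min \<epsilon> 1) \<le> a powr (1 / (2 * real m) + (- 1 / (2 * real m) + \<epsilon>))"
      using a by (intro powr_mono) auto
    also have "\<dots> = r * a powr (- 1 / (2 * real m) + \<epsilon>)"
      unfolding r_def by (rule powr_add)
    also have "\<dots> \<le> r * \<bar>Im l\<bar>" using \<beta> r by (intro mult_left_mono) auto
    finally have "a powr (min \<epsilon> 1) * cmod l \<le> (r * \<bar>Im l\<bar>) * (2 * a)"
      using True l r by (intro mult_mono) auto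
    then show ?thesis using l0 by (simp add: field_simps)
  next
    case False
    have "a powr (min \<epsilon> 1) \<le> a powr 1" using a by (intro powr_mono) auto
    also have "\<dots> \<le> r * a" using a r by simp
    finally have "a powr (min \<epsilon> 1) * cmod l \<le> (r * a) * (2 * \<bar>Im l\<bar>)"
      using False l r a by (intro mult_mono) auto
    then show ?thesis using l0 by (simp add: field_simps)
  qed
  then show ?thesis unfolding r_def .
qed

theorem theorem1p1:
  fixes m N :: nat and \<epsilon> :: real
  assumes "m \<ge> 1" and "\<epsilon> > 0"
  shows "\<exists>\<Psi> :: complex \<Rightarrow> (real \<Rightarrow> complex) \<times> (real \<Rightarrow> complex).
    (\<forall>l. \<Psi> l \<in> test_functions \<times> test_functions \<and> \<Psi> l \<noteq> (\<lambda>x. 0, \<lambda>x. 0)) \<and>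
    (\<exists>C > 0. \<exists>K > 0. \<forall>l.
      Re l \<le> - K \<and> \<bar>Im l\<bar> \<ge> \<bar>Re l\<bar> powr (- 1 / (2 * real m) + \<epsilon>) \<longrightarrow>
      Hnorm (\<lambda>x. 0) (generator_minus (\<lambda>x. 0) (\<lambda>x. x ^ (2 * m)) l (\<Psi> l))
        \<le> C * \<bar>Re l\<bar> powr (- real N) * Hnorm (\<lambda>x. 0) (\<Psi> l))"
proof -
  let ?test = "\<lambda>\<Psi>. \<Psi> \<in> test_functions \<times> test_functions \<and> \<Psi> \<noteq> (\<lambda>x. 0, \<lambda>x. 0)"
  have "2 * m \<ge> 1" using assms by simp
  then obtain h \<tau> c C K where pos: "0 < h" "0 < \<tau>" "0 < c" "0 < C" "0 < K"
    and quasi: "\<forall>k \<mu>. k \<ge> K \<longrightarrow> cmod \<mu> \<le> 1 \<longrightarrow>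
      (\<exists>f F. smooth f \<and> (\<forall>t. \<bar>t\<bar> > h \<longrightarrow> f t = 0) \<and> 0 < F \<and>
        (\<forall>t. 0 \<le> t \<longrightarrow> t \<le> \<tau> \<longrightarrow> F \<le> (cmod (f t))\<^sup>2) \<and>
        (\<forall>t. (cmod (D (D f) t + of_real (k\<^sup>2) * (1 - 2 * \<mu> * of_real ((1 + t) ^ (2 * m) - 1)) * f t))\<^sup>2
          \<le> C * k\<^sup>2 * exp (- c * (k * \<bar>Im \<mu>\<bar>)) * F * indicator {-h..h} t))"
    by (rule model_quasimode) (rule that)
  obtain C' where C': "C' > 0"
    "\<And>a. a \<ge> 1 \<Longrightarrow> exp (- (c / 2) * a powr (min \<epsilon> 1)) \<le> C' * a powr (- real (2 * N))"
    using exp_decay_powr[of "c / 2" "min \<epsilon> 1" "2 * N"] pos assms by auto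
  define B where "B = 2 * h * C / \<tau> * C'"
  have B: "B > 0" using pos C' by (simp add: B_def)
  have quasimode: "\<exists>\<Psi>. ?test \<Psi> \<and>
      Hnorm (\<lambda>x. 0) (generator_minus (\<lambda>x. 0) (\<lambda>x. x ^ (2 * m)) l \<Psi>)
        \<le> sqrt B * \<bar>Re l\<bar> powr (- real N) * Hnorm (\<lambda>x. 0) \<Psi>"
    if l: "Re l \<le> - max 1 K" "\<bar>Im l\<bar> \<ge> \<bar>Re l\<bar> powr (- 1 / (2 * real m) + \<epsilon>)" for l
  proof -
    define a where "a = - Re l"
    define r where "r = a powr (1 / (2 * real m))"
    define k where "k = r * cmod l"
    define \<mu> where "\<mu> = of_real a / cnj l"
    have a: "a \<ge> 1" "a \<ge> K" "Re l = - a" "\<bar>Re l\<bar> = a" using l by (auto simp: a_def)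
    have r: "r \<ge> 1" unfolding r_def using a by (intro ge_one_powr_ge_zero) auto
    have r2m: "r ^ (2 * m) = a"
      using a assms by (simp add: r_def powr_powr flip: powr_realpow)
    have la: "a \<le> cmod l" using abs_Re_le_cmod[of l] a by simp
    have l0: "l \<noteq> 0" "cmod l > 0" using la a by auto
    have "cmod l \<le> k" unfolding k_def using r mult_right_mono[of 1 r "cmod l"] by simp
    then have kK: "k \<ge> K" using la a by linarith
    have \<mu>1: "cmod \<mu> \<le> 1" using la l0 a by (simp add: \<mu>_def norm_divide)
    have "k * \<bar>Im \<mu>\<bar> = r * (a * \<bar>Im l\<bar> / cmod l)"
    proof -
      have "\<mu> = of_real (a / (cmod l)\<^sup>2) * l"
        using l0 complex_norm_square[of l] by (simp add: \<mu>_def field_simps)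
      then have "Im \<mu> = a / (cmod l)\<^sup>2 * Im l" by simp
      then show ?thesis using l0 a by (simp add: k_def abs_mult power2_eq_square)
    qed
    then have \<gamma>: "k * \<bar>Im \<mu>\<bar> \<ge> a powr (min \<epsilon> 1) / 2"
      using Gaussian_rate_lower_bound[OF a(1,3), of m \<epsilon>] l(2) a(4) by (simp add: r_def)
    obtain f F where f: "smooth f" "\<And>t. \<bar>t\<bar> > h \<Longrightarrow> f t = 0" and F: "0 < F"
      and lower: "\<And>t. 0 \<le> t \<Longrightarrow> t \<le> \<tau> \<Longrightarrow> F \<le> (cmod (f t))\<^sup>2"
      and upper: "\<And>t. (cmod (D (D f) t + of_real (k\<^sup>2) * (1 - 2 * \<mu> * of_real ((1 + t) ^ (2 * m) - 1)) * f t))\<^sup>2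
        \<le> C * k\<^sup>2 * exp (- c * (k * \<bar>Im \<mu>\<bar>)) * F * indicator {-h..h} t"
      using quasi[rule_format, OF kK \<mu>1] by blast
    \<comment> \<open>Undo the substitution \<open>x = r(1 + t)\<close>.\<close>
    define \<psi> where "\<psi> x = f (1 / r * x + - 1)" for x
    have s\<psi>: "smooth \<psi>" unfolding \<psi>_def by (rule smooth_compose_affine[OF f(1)])
    have \<psi>0: "\<psi> x = 0" if "x \<notin> {r * (1 - h)..r * (1 + h)}" for x
      unfolding \<psi>_def using that r by (intro f(2)) (auto simp: field_simps abs_if)
    have test: "?test (\<psi>, \<lambda>x. l * \<psi> x)"
    proof -
      have "(cmod (\<psi> r))\<^sup>2 \<ge> F" unfolding \<psi>_def using r pos by (intro lower) auto
      then have "\<psi> r \<noteq> 0" using F by auto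
      then have "(\<psi>, \<lambda>x. l * \<psi> x) \<noteq> (\<lambda>x. 0, \<lambda>x. 0)" by (auto simp: fun_eq_iff)
      moreover have "\<psi> \<in> test_functions" using s\<psi> \<psi>0 by (rule test_functionI)
      moreover have "(\<lambda>x. l * \<psi> x) \<in> test_functions"
        by (rule test_functionI[OF smooth_mult[OF smooth_const s\<psi>], of "r * (1 - h)" "r * (1 + h)"])
          (frule \<psi>0, simp)
      ultimately show ?thesis by simp
    qed
    have D2: "D (D \<psi>) x = of_real (1 / r\<^sup>2) * D (D f) (1 / r * x + - 1)" for x
    proof -
      have 1: "D \<psi> = (\<lambda>x. of_real (1 / r) * D f (1 / r * x + - 1))"
        unfolding \<psi>_def by (rule D_compose_affine[OF f(1)])
      have 2: "D (\<lambda>x. of_real (1 / r) * D f (1 / r * x + - 1))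
          = (\<lambda>x. of_real (1 / r) * D (\<lambda>x. D f (1 / r * x + - 1)) x)"
        by (rule D_cmult[OF smooth_compose_affine[OF smooth_D[OF f(1)]]])
      have 3: "D (\<lambda>x. D f (1 / r * x + - 1)) = (\<lambda>x. of_real (1 / r) * D (D f) (1 / r * x + - 1))"
        by (rule D_compose_affine[OF smooth_D[OF f(1)]])
      show ?thesis unfolding 1 2 3 by (simp add: power2_eq_square)
    qed
    have pot: "- (l * (l + 2 * of_real (x ^ (2 * m))))
        = of_real (1 / r\<^sup>2) * (of_real (k\<^sup>2) * (1 - 2 * \<mu> * of_real ((1 + (1 / r * x + - 1)) ^ (2 * m) - 1)))" for x
    proof -
      define y where "y = (x / r) ^ (2 * m)"
      have x: "x ^ (2 * m) = a * y"
        unfolding y_def power_divide r2m using a by simp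
      have y: "(1 + (1 / r * x + - 1)) ^ (2 * m) = y" by (simp add: y_def)
      have rk: "of_real (1 / r\<^sup>2) * (of_real (k\<^sup>2) * z) = l * cnj l * z" for z
        using r complex_norm_square[of l] by (simp add: k_def power_mult_distrib)
      have "of_real (1 / r\<^sup>2) * (of_real (k\<^sup>2) * (1 - 2 * \<mu> * of_real (y - 1)))
          = l * (cnj l - 2 * of_real a * of_real (y - 1))"
        unfolding rk using l0 by (simp add: \<mu>_def field_simps)
      also have "cnj l = - l - 2 * of_real a" using a by (simp add: complex_eq_iff)
      also have "l * (- l - 2 * of_real a - 2 * of_real a * of_real (y - 1)) = - (l * (l + 2 * of_real (a * y)))"
        by (simp add: algebra_simps)
      finally show ?thesis unfolding x y by simp
    qed
    define R where "R x = D (D \<psi>) x - l * (l + 2 * of_real (x ^ (2 * m))) * \<psi> x" for x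
    define E where "E = C * k\<^sup>2 * exp (- c * (k * \<bar>Im \<mu>\<bar>)) * F"
    have E0: "E \<ge> 0" using pos F by (simp add: E_def)
    have Rle: "(cmod (R x))\<^sup>2 \<le> E / r ^ 4 * indicator {r * (1 - h)..r * (1 + h)} x" for x
    proof -
      define t where "t = 1 / r * x + - 1"
      have "R x = of_real (1 / r\<^sup>2) *
          (D (D f) t + of_real (k\<^sup>2) * (1 - 2 * \<mu> * of_real ((1 + t) ^ (2 * m) - 1)) * f t)"
        using arg_cong[OF pot[of x], of "\<lambda>z. z * \<psi> x"]
        unfolding R_def D2 \<psi>_def t_def[symmetric] by (simp add: algebra_simps)
      then have "(cmod (R x))\<^sup>2 = (1 / r ^ 4) *
          (cmod (D (D f) t + of_real (k\<^sup>2) * (1 - 2 * \<mu> * of_real ((1 + t) ^ (2 * m) - 1)) * f t))\<^sup>2"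
        using r by (simp add: norm_mult norm_divide norm_power power_mult_distrib power_divide flip: power_mult)
      also have "\<dots> \<le> (1 / r ^ 4) * (E * indicator {-h..h} t)"
        unfolding E_def using r by (intro mult_left_mono upper) auto
      also have "indicator {-h..h} t = (indicator {r * (1 - h)..r * (1 + h)} x :: real)"
        using r by (auto simp: t_def indicator_def field_simps)
      finally show ?thesis by simp
    qed
    \<comment> \<open>The factor \<open>k\<^sup>2 = r\<^sup>2\<bar>l\<bar>\<^sup>2\<close> of the residual is absorbed by \<open>r\<^sup>-\<^sup>4\<close> from the scaling and by
      \<open>\<bar>l\<bar>\<^sup>2\<close> from the lower bound for the norm of the pair.\<close>
    have "(L2norm R)\<^sup>2 \<le> E / r ^ 4 * (r * (1 + h) - r * (1 - h))"
      using E0 r pos by (intro L2norm_power2_le Rle) (auto intro!: mult_left_mono)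
    also have "\<dots> = 2 * h * C * (cmod l)\<^sup>2 * exp (- c * (k * \<bar>Im \<mu>\<bar>)) * F / r"
      using r by (simp add: E_def k_def power_mult_distrib field_simps power2_eq_square numeral_eq_Suc)
    also have "\<dots> \<le> 2 * h * C * (cmod l)\<^sup>2 * exp (- c * (k * \<bar>Im \<mu>\<bar>)) * F * r"
    proof -
      have "1 / r \<le> r" using r mult_mono[of 1 r 1 r] by (simp add: field_simps)
      then have "2 * h * C * (cmod l)\<^sup>2 * exp (- c * (k * \<bar>Im \<mu>\<bar>)) * F * (1 / r)
          \<le> 2 * h * C * (cmod l)\<^sup>2 * exp (- c * (k * \<bar>Im \<mu>\<bar>)) * F * r"
        using pos F by (intro mult_left_mono) auto
      then show ?thesis by simp
    qed
    also have "\<dots> = 2 * h * C / \<tau> * exp (- c * (k * \<bar>Im \<mu>\<bar>)) * ((cmod l)\<^sup>2 * (F * (r * (1 + \<tau>) - r)))"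
      using pos by (simp add: field_simps)
    also have "\<dots> \<le> 2 * h * C / \<tau> * (C' * a powr (- real (2 * N))) * (Hnorm (\<lambda>x. 0) (\<psi>, \<lambda>x. l * \<psi> x))\<^sup>2"
    proof (intro mult_mono mult_left_mono)
      have "- c * (k * \<bar>Im \<mu>\<bar>) \<le> - (c / 2) * a powr (min \<epsilon> 1)"
        using mult_left_mono[OF \<gamma>, of c] pos by simp
      then have "exp (- c * (k * \<bar>Im \<mu>\<bar>)) \<le> exp (- (c / 2) * a powr (min \<epsilon> 1))" by simp
      then show "exp (- c * (k * \<bar>Im \<mu>\<bar>)) \<le> C' * a powr (- real (2 * N))"
        using C'(2)[OF a(1)] by linarith
      have "F * (r * (1 + \<tau>) - r) \<le> (L2norm \<psi>)\<^sup>2"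
      proof (rule L2norm_power2_ge)
        show "continuous_on UNIV \<psi>" by (rule continuous_smooth[OF s\<psi>])
        show "r \<le> r * (1 + \<tau>)" using r pos by simp
        show "F \<le> (cmod (\<psi> x))\<^sup>2" if "x \<in> {r..r * (1 + \<tau>)}" for x
          unfolding \<psi>_def using that r by (intro lower) (auto simp: field_simps)
      qed (rule \<psi>0)
      then have "(cmod l)\<^sup>2 * (F * (r * (1 + \<tau>) - r)) \<le> (cmod l * L2norm \<psi>)\<^sup>2"
        by (simp add: power_mult_distrib mult_left_mono)
      also have "\<dots> \<le> (Hnorm (\<lambda>x. 0) (\<psi>, \<lambda>x. l * \<psi> x))\<^sup>2"
        by (intro power_mono Hnorm_ge mult_nonneg_nonneg)
          (auto simp: L2norm_def intro!: real_sqrt_ge_zero integral_nonneg)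
      finally show "(cmod l)\<^sup>2 * (F * (r * (1 + \<tau>) - r)) \<le> (Hnorm (\<lambda>x. 0) (\<psi>, \<lambda>x. l * \<psi> x))\<^sup>2" .
    qed (use pos C' F r in auto)
    also have "\<dots> = (sqrt B * a powr (- real N) * Hnorm (\<lambda>x. 0) (\<psi>, \<lambda>x. l * \<psi> x))\<^sup>2"
    proof -
      have "a powr (- real (2 * N)) = (a powr (- real N))\<^sup>2"
        unfolding power2_eq_square by (simp flip: powr_add)
      then show ?thesis using B by (simp add: B_def power_mult_distrib)
    qed
    finally have "L2norm R \<le> sqrt B * a powr (- real N) * Hnorm (\<lambda>x. 0) (\<psi>, \<lambda>x. l * \<psi> x)"
      by (rule power2_le_imp_le) (use B in \<open>auto simp: Hnorm_def\<close>)
    then have "Hnorm (\<lambda>x. 0) (generator_minus (\<lambda>x. 0) (\<lambda>x. x ^ (2 * m)) l (\<psi>, \<lambda>x. l * \<psi> x))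
        \<le> sqrt B * \<bar>Re l\<bar> powr (- real N) * Hnorm (\<lambda>x. 0) (\<psi>, \<lambda>x. l * \<psi> x)"
      unfolding Hnorm_generator_minus R_def a(4) .
    then show ?thesis using test by blast
  qed
  \<comment> \<open>Where the hypotheses on \<open>l\<close> fail, any nonzero pair of test functions serves.\<close>
  have default: "\<exists>\<Psi>. ?test \<Psi>"
  proof -
    obtain \<phi> X where \<phi>: "smooth \<phi>" "\<And>t. \<bar>t\<bar> \<le> 1 / 2 \<Longrightarrow> \<phi> t = 1" "\<And>t. \<bar>t\<bar> \<ge> 1 \<Longrightarrow> \<phi> t = 0"
      using cutoff_exists[of 1] by auto
    have "\<phi> \<in> test_functions" by (rule test_functionI[of _ "-1" 1]) (use \<phi> in auto)
    moreover have "\<phi> \<noteq> (\<lambda>x. 0)" using \<phi>(2)[of 0] by (metis abs_zero zero_le_divide_1_iff zero_le_numeral zero_neq_one)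
    ultimately show ?thesis by auto
  qed
  have "\<forall>l. \<exists>\<Psi>. ?test \<Psi> \<and>
      (Re l \<le> - max 1 K \<and> \<bar>Im l\<bar> \<ge> \<bar>Re l\<bar> powr (- 1 / (2 * real m) + \<epsilon>) \<longrightarrow>
      Hnorm (\<lambda>x. 0) (generator_minus (\<lambda>x. 0) (\<lambda>x. x ^ (2 * m)) l \<Psi>)
        \<le> sqrt B * \<bar>Re l\<bar> powr (- real N) * Hnorm (\<lambda>x. 0) \<Psi>)"
    using quasimode default by blast
  then obtain \<Psi> where "\<And>l. ?test (\<Psi> l)" and
    "\<And>l. Re l \<le> - max 1 K \<and> \<bar>Im l\<bar> \<ge> \<bar>Re l\<bar> powr (- 1 / (2 * real m) + \<epsilon>) \<Longrightarrow>
      Hnorm (\<lambda>x. 0) (generator_minus (\<lambda>x. 0) (\<lambda>x. x ^ (2 * m)) l (\<Psi> l))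
        \<le> sqrt B * \<bar>Re l\<bar> powr (- real N) * Hnorm (\<lambda>x. 0) (\<Psi> l)"
    by metis
  moreover have "sqrt B > 0" "max 1 K > 0" using B by auto
  ultimately show ?thesis by blast
qed

end
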